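(* Let $k\in\hat I$. Let $\mathcal{PP}_k$ be the set of sequences $((\lambda^{(j)},\mu^{(j)}))_{j\ge1}$ with $(\lambda^{(j)},\mu^{(j)})\in\mathcal P_k^{s_k}$ for all $j$, $(\lambda^{(j)},\mu^{(j)})\ge_k(\lambda^{(j+1)},\mu^{(j+1)})$ for all $j\ge1$, and $\lambda^{(j)}=\mu^{(j)}=0$ for all but finitely many $j$ (plane $\mathbf s$-partitions). Then, as formal power series in $z_0,\dots,z_{N-1}$, $$\sum_{((\lambda^{(j)},\mu^{(j)}))_j\in\mathcal{PP}_k}\ \prod_{j\ge1}\mathrm{wt}_k(\lambda^{(j)},\mu^{(j)})=\prod_{i\le k}\ \prod_{j\ge k}\big(1-\sigma(i,j)z_{i,j}\big)^{-\sigma(i,j)},$$ i.e. this is the character of the MacMahon module $\mathcal M_k$ of $\mathcal E_{\mathbf s}$.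
   Context: Fix $m\ne n$, $N=m+n\ge3$ and a parity sequence $\mathbf s=(s_1,\dots,s_N)\in\{1,-1\}^N$ with exactly $m$ entries $1$, extended by $s_{i+N}=s_i$; $\hat I=\{0,\dots,N-1\}$; $|t|=(1-s_ts_{t+1})/2$ and $\sigma(i,j)=(-1)^{\sum_{t=i}^j|t|}$ for integers $i\le j$. Formal variables $z_0,\dots,z_{N-1}$, $z_{t+N}=z_t$, $z_{i,j}=\prod_{t=i}^jz_t$. For $k\in\mathbb Z$, $\epsilon\in\{1,-1\}$, $\mathcal P_k^\epsilon$ is the set of pairs $(\lambda,\mu)$ of weakly decreasing sequences of non-negative integers $\lambda=(\lambda_1,\lambda_2,\dots)$, $\mu=(\mu_1,\mu_2,\dots)$, finitely many nonzero, such that: $\mu_j=0$ whenever $\lambda_j=0$; $\lambda_j=\lambda_{j+1}$ only if $s_{k+\lambda_j}=\epsilon$ or $\lambda_j=\mu_j=0$; $\mu_j=\mu_{j+1}$ only if $s_{k-\mu_j}=\epsilon$ or $\mu_j=\lambda_{j+1}=0$. $\ell(\lambda)$ denotes the number of nonzero entries. $\mathrm{wt}_k(\lambda,\mu)=\prod_{j\ge1}\prod_{t=0}^{\lambda_j-1}z_{k+t}\cdot\prod_{j\ge1}\prod_{t=1}^{\mu_j}z_{k-t}$ (counts boxes of each colour mod $N$). For two such pairs, $(\lambda^{(1)},\mu^{(1)})\ge_k(\lambda^{(2)},\mu^{(2)})$ means: $\ell(\lambda^{(2)})\le\ell(\mu^{(1)})$, $\ell(\lambda^{(2)})\le\ell(\lambda^{(1)})$,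 $\ell(\mu^{(2)})\le\ell(\mu^{(1)})$; for $i=1,\dots,\ell(\lambda^{(2)})$, $\lambda^{(1)}_i\ge\lambda^{(2)}_i$ with equality allowed only if $s_{\lambda^{(1)}_i+k}=-s_k$ or $\lambda^{(1)}_i=0$; for $i=1,\dots,\ell(\mu^{(2)})$, $\mu^{(1)}_i\ge\mu^{(2)}_i$ with equality allowed only if $s_{-\mu^{(1)}_i+k}=-s_k$ or $\mu^{(1)}_i=0$. The set $\mathcal{PP}_k$ indexes a basis of the MacMahon module $\mathcal M_k$, whose grading counts boxes of each colour (highest weight vector of degree 1). *)

theory Defs
  imports Main "HOL-Library.Poly_Mapping" "HOL-Library.FuncSet"
begin

text \<open>Monomials in the variables z_0, z_1, ... are finitely supported exponent
vectors nat =>0 nat; a formal power series is its coefficient function.\<close>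

type_synonym mono = "nat \<Rightarrow>\<^sub>0 nat"
type_synonym mfps = "mono \<Rightarrow> int"

definition mfps_one :: mfps where
  "mfps_one a = (if a = 0 then 1 else 0)"

definition mfps_monom :: "int \<Rightarrow> mono \<Rightarrow> mfps" where
  "mfps_monom c e a = (if a = e then c else 0)"

definition mfps_minus :: "mfps \<Rightarrow> mfps \<Rightarrow> mfps" where
  "mfps_minus f g a = f a - g a"

definition mfps_times :: "mfps \<Rightarrow> mfps \<Rightarrow> mfps" where
  "mfps_times f g a = (\<Sum>(b, c) \<in> {(b, c). b + c = a}. f b * g c)"

definition mfps_inverse :: "mfps \<Rightarrow> mfps" where
  "mfps_inverse f = (THE g. mfps_times f g = mfps_one)"

fun mfps_power :: "mfps \<Rightarrow> nat \<Rightarrow> mfps" where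
  "mfps_power f 0 = mfps_one"
| "mfps_power f (Suc r) = mfps_times f (mfps_power f r)"

definition mfps_zpow :: "mfps \<Rightarrow> int \<Rightarrow> mfps" where
  "mfps_zpow f e = (if 0 \<le> e then mfps_power f (nat e) else mfps_power (mfps_inverse f) (nat (- e)))"

definition mfps_prod :: "'i set \<Rightarrow> ('i \<Rightarrow> mfps) \<Rightarrow> mfps" where
  "mfps_prod F f a =
     (\<Sum>c \<in> {c. c \<in> F \<rightarrow>\<^sub>E UNIV \<and> (\<Sum>x\<in>F. c x) = a}. \<Prod>x\<in>F. f x (c x))"

definition mfps_sum :: "'i set \<Rightarrow> ('i \<Rightarrow> mfps) \<Rightarrow> mfps" where
  "mfps_sum F f a = (\<Sum>x\<in>F. f x a)"

text \<open>Limit along the net of finite subsets of I, in the (coefficientwise discrete)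
topology of formal power series.\<close>
definition mfps_net_converges :: "'i set \<Rightarrow> ('i set \<Rightarrow> mfps) \<Rightarrow> bool" where
  "mfps_net_converges I G \<longleftrightarrow> (\<forall>a. \<exists>c F0. finite F0 \<and> F0 \<subseteq> I \<and>
      (\<forall>F. finite F \<and> F0 \<subseteq> F \<and> F \<subseteq> I \<longrightarrow> G F a = c))"

definition mfps_net_lim :: "'i set \<Rightarrow> ('i set \<Rightarrow> mfps) \<Rightarrow> mfps" where
  "mfps_net_lim I G a = (THE c. \<exists>F0. finite F0 \<and> F0 \<subseteq> I \<and>
      (\<forall>F. finite F \<and> F0 \<subseteq> F \<and> F \<subseteq> I \<longrightarrow> G F a = c))"

definition mfps_infsum :: "'i set \<Rightarrow> ('i \<Rightarrow> mfps) \<Rightarrow> mfps" where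
  "mfps_infsum I f = mfps_net_lim I (\<lambda>F. mfps_sum F f)"

definition mfps_infprod :: "'i set \<Rightarrow> ('i \<Rightarrow> mfps) \<Rightarrow> mfps" where
  "mfps_infprod I f = mfps_net_lim I (\<lambda>F. mfps_prod F f)"

definition parity_seq :: "nat \<Rightarrow> nat \<Rightarrow> (int \<Rightarrow> int) \<Rightarrow> bool" where
  "parity_seq m n s \<longleftrightarrow> m \<noteq> n \<and> 3 \<le> m + n \<and> (\<forall>i. s i = 1 \<or> s i = -1) \<and>
     (\<forall>i. s (i + int (m + n)) = s i) \<and> card {i \<in> {1..int (m + n)}. s i = 1} = m"

definition bar :: "(int \<Rightarrow> int) \<Rightarrow> int \<Rightarrow> int" where
  "bar s t = (1 - s t * s (t + 1)) div 2"

definition sgn_s :: "(int \<Rightarrow> int) \<Rightarrow> int \<Rightarrow> int \<Rightarrow> int" where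
  "sgn_s s i j = (-1) ^ nat (\<Sum>t\<in>{i..j}. bar s t)"

definition zvar :: "nat \<Rightarrow> int \<Rightarrow> mono" where
  "zvar N t = Poly_Mapping.single (nat (t mod int N)) 1"

definition zij :: "nat \<Rightarrow> int \<Rightarrow> int \<Rightarrow> mono" where
  "zij N i j = (\<Sum>t\<in>{i..j}. zvar N t)"

text \<open>A partition is a function nat => nat; entry lam (j-1) is the paper's lambda_j
(0-based indexing).\<close>

definition is_part :: "(nat \<Rightarrow> nat) \<Rightarrow> bool" where
  "is_part lam \<longleftrightarrow> (\<forall>j. lam (Suc j) \<le> lam j) \<and> (\<exists>r. \<forall>j\<ge>r. lam j = 0)"

definition len :: "(nat \<Rightarrow> nat) \<Rightarrow> nat" where
  "len lam = card {j. lam j \<noteq> 0}"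

definition P_set :: "(int \<Rightarrow> int) \<Rightarrow> int \<Rightarrow> int \<Rightarrow> ((nat \<Rightarrow> nat) \<times> (nat \<Rightarrow> nat)) set" where
  "P_set s k \<epsilon> = {(lam, mu). is_part lam \<and> is_part mu \<and>
     (\<forall>j. lam j = 0 \<longrightarrow> mu j = 0) \<and>
     (\<forall>j. lam j = lam (Suc j) \<longrightarrow> s (k + int (lam j)) = \<epsilon> \<or> (lam j = 0 \<and> mu j = 0)) \<and>
     (\<forall>j. mu j = mu (Suc j) \<longrightarrow> s (k - int (mu j)) = \<epsilon> \<or> (mu j = 0 \<and> lam (Suc j) = 0))}"

definition wt :: "nat \<Rightarrow> int \<Rightarrow> (nat \<Rightarrow> nat) \<times> (nat \<Rightarrow> nat) \<Rightarrow> mono" where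
  "wt N k p = (case p of (lam, mu) \<Rightarrow>
      (\<Sum>j\<in>{j. lam j \<noteq> 0}. \<Sum>t\<in>{0..<lam j}. zvar N (k + int t)) +
      (\<Sum>j\<in>{j. mu j \<noteq> 0}. \<Sum>t\<in>{1..mu j}. zvar N (k - int t)))"

definition geq_k :: "(int \<Rightarrow> int) \<Rightarrow> int \<Rightarrow> (nat \<Rightarrow> nat) \<times> (nat \<Rightarrow> nat)
     \<Rightarrow> (nat \<Rightarrow> nat) \<times> (nat \<Rightarrow> nat) \<Rightarrow> bool" where
  "geq_k s k p1 p2 = (case p1 of (lam1, mu1) \<Rightarrow> case p2 of (lam2, mu2) \<Rightarrow>
      len lam2 \<le> len mu1 \<and> len lam2 \<le> len lam1 \<and> len mu2 \<le> len mu1 \<and>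
      (\<forall>i < len lam2. lam2 i \<le> lam1 i \<and>
          (lam1 i = lam2 i \<longrightarrow> s (int (lam1 i) + k) = - s k \<or> lam1 i = 0)) \<and>
      (\<forall>i < len mu2. mu2 i \<le> mu1 i \<and>
          (mu1 i = mu2 i \<longrightarrow> s (k - int (mu1 i)) = - s k \<or> mu1 i = 0)))"

text \<open>Plane s-partitions: sequences indexed from 0 (paper: from 1).\<close>
definition PP_set :: "(int \<Rightarrow> int) \<Rightarrow> int \<Rightarrow> (nat \<Rightarrow> (nat \<Rightarrow> nat) \<times> (nat \<Rightarrow> nat)) set" where
  "PP_set s k = {P. (\<forall>j. P j \<in> P_set s k (s k)) \<and> (\<forall>j. geq_k s k (P j) (P (Suc j))) \<and>
      (\<exists>r. \<forall>j\<ge>r. P j = (\<lambda>_. 0, \<lambda>_. 0))}"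

definition wtPP :: "nat \<Rightarrow> int \<Rightarrow> (nat \<Rightarrow> (nat \<Rightarrow> nat) \<times> (nat \<Rightarrow> nat)) \<Rightarrow> mono" where
  "wtPP N k P = (\<Sum>j\<in>{j. P j \<noteq> (\<lambda>_. 0, \<lambda>_. 0)}. wt N k (P j))"

definition macfactor :: "nat \<Rightarrow> (int \<Rightarrow> int) \<Rightarrow> int \<times> int \<Rightarrow> mfps" where
  "macfactor N s ij = (case ij of (i, j) \<Rightarrow>
     mfps_zpow (mfps_minus mfps_one (mfps_monom (sgn_s s i j) (zij N i j))) (- sgn_s s i j))"

end

theory Submission
  imports Defs
begin

text \<open>
  Reading \<open>\<lambda>\<^sup>(\<^sup>j\<^sup>)\<close> and \<open>\<mu>\<^sup>(\<^sup>j\<^sup>)\<close> as the \<open>j\<close>-th rows of two arrays, a plane s-partition is a pair of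
  semistandard supertableaux of one common shape with decreasing entries. The entries
  \<open>a \<ge> 1\<close> of the first have parity \<open>s (k + a) * s k\<close>, the entries \<open>b \<ge> 0\<close> of the second have
  parity \<open>s (k - b) * s k\<close>; the entry 0 of the second array is an even letter. Hence the
  generating function is the super Cauchy identity, whose factors are indexed by pairs
  \<open>(i, j) = (k - b, k + a - 1)\<close>.

  The cells with entry at least \<open>l\<close> form a decreasing chain of partitions whose steps are horizontal
  strips (even letters) or vertical strips (odd letters). The Cauchy identity is proved
  bijectively by local growth rules: a peak \<open>lam \<subseteq> nu \<supseteq> mu\<close> of such strips corresponds to a
  valley \<open>lam \<supseteq> kap \<subseteq> mu\<close> together with a multiplicity, which is at most 1 if the two strips
  have different types. Moving all steps past each other leaves a matrix of multiplicities, and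
  its weight enumerator is the product of the factors.
\<close>

section \<open>Weight-preserving bijections\<close>

text \<open>Since \<open>sgn_s s i j\<close> telescopes to \<open>s i * s (j + 1)\<close>, every
  factor is \<open>1 / (1 - z)\<close> or \<open>1 + z\<close>. No cancellation occurs: both
  coefficients at a monomial are cardinalities, so the argument can run through bijections and meets
  series only at the end. Two obstacles shape it. The conditions linking the two arrays do not give
  them equal supports: they make the support of the second that of the first minus a horizontal
  strip. Filling this strip with a letter 0 of weight 0 restores a common shape, which is why left
  letters start at 0 and right letters at 1. Moreover both alphabets are infinite, while the growth
  argument consumes letters one at a time. Entries are therefore bounded by some \<open>L\<close>.
  The number of boxes bounds every entry, so a large \<open>L\<close> loses nothing in a fixed
  degree, and factors belonging to longer intervals contribute only their constant term.\<close>

definition weq :: "'a set \<Rightarrow> ('a \<Rightarrow> 'w) \<Rightarrow> 'b set \<Rightarrow> ('b \<Rightarrow> 'w) \<Rightarrow> bool" where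
  "weq A f B g \<longleftrightarrow> (\<exists>h. bij_betw h A B \<and> (\<forall>x\<in>A. g (h x) = f x))"

lemma weqI:
  assumes "\<And>x. x \<in> A \<Longrightarrow> h x \<in> B \<and> h' (h x) = x \<and> g (h x) = f x"
    and "\<And>y. y \<in> B \<Longrightarrow> h' y \<in> A \<and> h (h' y) = y"
  shows "weq A f B g"
proof -
  have "bij_betw h A B"
    by (rule bij_betw_byWitness[where f' = h']) (use assms in auto)
  then show ?thesis using assms(1) unfolding weq_def by blast
qed

lemma weq_refl: "(\<And>x. x \<in> A \<Longrightarrow> f x = g x) \<Longrightarrow> weq A f A g"
  by (rule weqI[where h = id and h' = id]) auto

lemma weq_sym: "weq A f B g \<Longrightarrow> weq B g A f"
  unfolding weq_def
proof (elim exE conjE)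
  fix h assume h: "bij_betw h A B" "\<forall>x\<in>A. g (h x) = f x"
  have "f (inv_into A h y) = g y" if "y \<in> B" for y
    using h(2) bij_betw_inv_into_right[OF h(1) that] bij_betwE[OF bij_betw_inv_into[OF h(1)]] that
    by metis
  then show "\<exists>h. bij_betw h B A \<and> (\<forall>x\<in>B. f (h x) = g x)"
    using bij_betw_inv_into[OF h(1)] by blast
qed

lemma weq_trans [trans]: "weq A f B g \<Longrightarrow> weq B g C e \<Longrightarrow> weq A f C e"
  unfolding weq_def
proof (elim exE conjE)
  fix h h' assume h: "bij_betw h A B" "\<forall>x\<in>A. g (h x) = f x"
    "bij_betw h' B C" "\<forall>x\<in>B. e (h' x) = g x"
  then have "bij_betw (h' \<circ> h) A C" "\<forall>x\<in>A. e ((h' \<circ> h) x) = f x"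
    by (auto intro: bij_betw_trans dest: bij_betwE)
  then show "\<exists>h. bij_betw h A C \<and> (\<forall>x\<in>A. e (h x) = f x)" by blast
qed

text \<open>One statistic can carry several weights: if the wanted weights are a common function
  \<open>F\<close> of a statistic already transported, the same bijection serves. For this reason
  the growth rules only track \<open>psize\<close>.\<close>

lemma weq_weight: "weq A f B g \<Longrightarrow> (\<And>x. x \<in> A \<Longrightarrow> f' x = F (f x)) \<Longrightarrow>
  (\<And>y. y \<in> B \<Longrightarrow> g' y = F (g y)) \<Longrightarrow> weq A f' B g'"
  unfolding weq_def by (metis bij_betwE)

lemma weq_Sigma:
  assumes "\<And>i. i \<in> I \<Longrightarrow> weq (A i) (f i) (B i) (g i)"
  shows "weq (Sigma I A) (\<lambda>(i, x). f i x) (Sigma I B) (\<lambda>(i, x). g i x)"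
proof -
  from assms obtain h where h: "\<And>i. i \<in> I \<Longrightarrow> bij_betw (h i) (A i) (B i)"
    "\<And>i x. i \<in> I \<Longrightarrow> x \<in> A i \<Longrightarrow> g i (h i x) = f i x"
    unfolding weq_def by metis
  show ?thesis
  proof (rule weqI[where h = "\<lambda>(i, x). (i, h i x)" and h' = "\<lambda>(i, x). (i, inv_into (A i) (h i) x)"])
    fix z assume z: "z \<in> Sigma I A"
    then obtain i x where [simp]: "z = (i, x)" and ix: "i \<in> I" "x \<in> A i" by auto
    then show "(case z of (i, x) \<Rightarrow> (i, h i x)) \<in> Sigma I B \<and>
       (case case z of (i, x) \<Rightarrow> (i, h i x) of (i, x) \<Rightarrow> (i, inv_into (A i) (h i) x)) = z \<and>
       (case case z of (i, x) \<Rightarrow> (i, h i x) of (i, x) \<Rightarrow> g i x) = (case z of (i, x) \<Rightarrow> f i x)"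
      using h bij_betw_inv_into_left[OF h(1)] by (auto dest: bij_betwE)
  next
    fix z assume z: "z \<in> Sigma I B"
    then obtain i x where [simp]: "z = (i, x)" and ix: "i \<in> I" "x \<in> B i" by auto
    then show "(case z of (i, x) \<Rightarrow> (i, inv_into (A i) (h i) x)) \<in> Sigma I A \<and>
       (case case z of (i, x) \<Rightarrow> (i, inv_into (A i) (h i) x) of (i, x) \<Rightarrow> (i, h i x)) = z"
      using bij_betw_inv_into_right[OF h(1)] bij_betwE[OF bij_betw_inv_into[OF h(1)]] by auto
  qed
qed

lemma weq_Sigma_uncurried:
  assumes "\<And>i. i \<in> I \<Longrightarrow> weq (A i) (\<lambda>x. f (i, x)) (B i) (\<lambda>x. g (i, x))"
  shows "weq (Sigma I A) f (Sigma I B) g"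
  using weq_Sigma[of I A "\<lambda>i x. f (i, x)" B "\<lambda>i x. g (i, x)"] assms by simp

lemma weq_prod:
  assumes "weq A f B g" "weq A' f' B' g'"
  shows "weq (A \<times> A') (\<lambda>(x, x'). F (f x) (f' x')) (B \<times> B') (\<lambda>(y, y'). F (g y) (g' y'))"
proof -
  obtain h h' where h: "bij_betw h A B" "\<forall>x\<in>A. g (h x) = f x" "bij_betw h' A' B'" "\<forall>x\<in>A'. g' (h' x) = f' x"
    using assms unfolding weq_def by blast
  have "bij_betw (map_prod h h') (A \<times> A') (B \<times> B')"
    using bij_betw_map_prod[OF h(1,3)] .
  then show ?thesis using h(2,4) unfolding weq_def by force
qed

lemma weq_times:
  assumes "weq A f B g"
  shows "weq (A \<times> C) (\<lambda>(x, c). F (f x) c) (B \<times> C) (\<lambda>(x, c). F (g x) c)"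
  using weq_prod[OF assms weq_refl[of C id id], of F] by simp

text \<open>The way back from bijections to coefficients. Finiteness is transported separately
  because \<open>card\<close> is 0 on infinite sets.\<close>

lemma weq_finite_card:
  assumes "weq A f B g"
  shows "finite {x \<in> A. f x = a} \<longleftrightarrow> finite {x \<in> B. g x = a}"
    and "card {x \<in> A. f x = a} = card {x \<in> B. g x = a}"
proof -
  obtain h where h: "bij_betw h A B" "\<forall>x\<in>A. g (h x) = f x"
    using assms unfolding weq_def by blast
  have "bij_betw h {x \<in> A. f x = a} {x \<in> B. g x = a}"
    using h unfolding bij_betw_def by (auto simp: inj_on_def)
  then show "finite {x \<in> A. f x = a} \<longleftrightarrow> finite {x \<in> B. g x = a}"
    "card {x \<in> A. f x = a} = card {x \<in> B. g x = a}"
    by (auto dest: bij_betw_finite bij_betw_same_card)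
qed

lemma weq_Pow:
  assumes "finite I" "finite J" "card I = card J"
  shows "weq (Pow I) card (Pow J) card"
proof -
  obtain h where h: "bij_betw h I J"
    using finite_same_card_bij assms by blast
  have "bij_betw ((`) h) (Pow I) (Pow J)" by (rule bij_betw_Pow[OF h])
  moreover have "\<forall>E\<in>Pow I. card (h ` E) = card E"
    using h by (auto simp: bij_betw_def intro!: card_image elim: inj_on_subset)
  ultimately show ?thesis unfolding weq_def by blast
qed

lemma weq_Pow_insert:
  assumes "finite J" "z \<notin> J"
  shows "weq (Pow (insert z J)) card ({0, 1} \<times> Pow J) (\<lambda>(m, F). m + card F)"
proof (rule weqI[where h = "\<lambda>E. (if z \<in> E then 1 else 0, E - {z})"
      and h' = "\<lambda>(m, F). if m = 0 then F else insert z F"])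
  fix E assume E: "E \<in> Pow (insert z J)"
  then have "finite E" using assms finite_subset by auto
  then show "(if z \<in> E then 1 else 0, E - {z}) \<in> {0, 1::nat} \<times> Pow J \<and>
      (case (if z \<in> E then 1 else 0::nat, E - {z}) of (m, F) \<Rightarrow> if m = 0 then F else insert z F) = E \<and>
      (case (if z \<in> E then 1 else 0, E - {z}) of (m, F) \<Rightarrow> m + card F) = card E"
    using E card_Suc_Diff1[of E z] by auto
qed (use assms in auto)

section \<open>Local growth rules\<close>

lemma is_part_mono: "is_part lam \<Longrightarrow> i \<le> j \<Longrightarrow> lam j \<le> lam i"
  unfolding is_part_def by (metis lift_Suc_antimono_le)

lemma is_part_finite: "is_part lam \<Longrightarrow> finite {i. c < lam i}"
  unfolding is_part_def
  by (metis (mono_tags, lifting) bounded_nat_set_is_finite mem_Collect_eq not_less not_less_zero)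

definition conj_part :: "(nat \<Rightarrow> nat) \<Rightarrow> nat \<Rightarrow> nat" where
  "conj_part lam c = card {i. c < lam i}"

text \<open>The rows longer than \<open>c\<close> form an initial segment, so their number is the
  first index outside it. With \<open>nat_eq_less\<close> and \<open>nat_le_less\<close> this turns
  comparisons of conjugates into statements about single cells.\<close>

lemma less_conj_part: 
  assumes "is_part lam" shows "i < conj_part lam c \<longleftrightarrow> c < lam i"
proof -
  have fin: "finite {i. c < lam i}" using assms is_part_finite by blast
  have dc: "c < lam i \<Longrightarrow> i' \<le> i \<Longrightarrow> c < lam i'" for i i'
    using is_part_mono[OF assms, of i' i] by linarith
  show ?thesis
  proof
    assume "c < lam i"
    then have "{..i} \<subseteq> {i. c < lam i}" using dc by auto
    from card_mono[OF fin this] show "i < conj_part lam c" by (simp add: conj_part_def)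
  next
    assume i: "i < conj_part lam c"
    show "c < lam i"
    proof (rule ccontr)
      assume "\<not> c < lam i"
      then have "{i. c < lam i} \<subseteq> {..<i}" 
        by (metis (mono_tags) dc lessThan_iff mem_Collect_eq not_less subsetI)
      then have "conj_part lam c \<le> i" unfolding conj_part_def
        using card_mono[of "{..<i}"] by simp
      with i show False by simp
    qed
  qed
qed

lemma nat_eq_less: "(\<And>i::nat. i < a \<longleftrightarrow> i < b) \<Longrightarrow> a = b"
  by (metis linorder_neqE_nat nat_less_le)

lemma nat_le_less: "a \<le> b \<longleftrightarrow> (\<forall>i::nat. i < a \<longrightarrow> i < b)"
  by (metis leI less_le_trans less_irrefl)

lemma is_part_conj: assumes "is_part lam" shows "is_part (conj_part lam)"
proof -
  have "conj_part lam (Suc j) \<le> conj_part lam j" for j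
    by (auto simp: nat_le_less less_conj_part[OF assms])
  moreover have "conj_part lam j = 0" if "j \<ge> lam 0" for j
  proof -
    have "\<not> j < lam i" for i using is_part_mono[OF assms, of 0 i] that by auto
    then show ?thesis by (simp add: conj_part_def)
  qed
  ultimately show ?thesis unfolding is_part_def by blast
qed

lemma conj_conj: "is_part lam \<Longrightarrow> conj_part (conj_part lam) = lam"
  by (intro ext nat_eq_less) (simp add: less_conj_part is_part_conj)

definition psize :: "(nat \<Rightarrow> nat) \<Rightarrow> nat" where
  "psize lam = (\<Sum>i | lam i \<noteq> 0. lam i)"

lemma psize_eq: "(\<And>i. i \<ge> n \<Longrightarrow> lam i = 0) \<Longrightarrow> psize lam = sum lam {..<n}"
  unfolding psize_def by (rule sum.mono_neutral_left) (auto intro: ccontr simp: not_less)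

lemma psize_mono:
  assumes "is_part nu" "\<And>i. lam i \<le> nu i" shows "psize lam \<le> psize nu"
proof -
  obtain n where "\<And>i. i \<ge> n \<Longrightarrow> nu i = 0" using assms(1) is_part_def by auto
  moreover then have "\<And>i. i \<ge> n \<Longrightarrow> lam i = 0" using assms(2) by (metis le_zero_eq)
  ultimately show ?thesis using psize_eq[of n] assms(2) by (simp add: sum_mono)
qed

lemma psize_conj: assumes "is_part lam" shows "psize (conj_part lam) = psize lam"
proof -
  have *: "psize nu = card {(i, c). c < nu i}" if nu: "is_part nu" for nu
  proof -
    have "{(i, c). c < nu i} = Sigma {i. nu i \<noteq> 0} (\<lambda>i. {..<nu i})" by auto
    then show ?thesis using is_part_finite[OF nu, of 0] 
      by (simp add: psize_def)
  qed
  have "{(i, c). c < conj_part lam i} = prod.swap ` {(i, c). c < lam i}"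
    using less_conj_part[OF assms] by force
  then have "card {(i, c). c < conj_part lam i} = card {(i, c). c < lam i}"
    by (simp add: card_image)
  then show ?thesis using *[OF assms] *[OF is_part_conj[OF assms]] by simp
qed

section \<open>Horizontal and vertical strips\<close>

definition hstrip :: "(nat \<Rightarrow> nat) \<Rightarrow> (nat \<Rightarrow> nat) \<Rightarrow> bool" where
  "hstrip kap nu \<longleftrightarrow> is_part kap \<and> is_part nu \<and> (\<forall>i. kap i \<le> nu i \<and> nu (Suc i) \<le> kap i)"

definition vstrip :: "(nat \<Rightarrow> nat) \<Rightarrow> (nat \<Rightarrow> nat) \<Rightarrow> bool" where
  "vstrip kap nu \<longleftrightarrow> is_part kap \<and> is_part nu \<and> (\<forall>i. kap i \<le> nu i \<and> nu i \<le> Suc (kap i))"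

text \<open>\<open>True\<close> stands for an odd letter, whose cells form a vertical strip.\<close>

definition strip :: "bool \<Rightarrow> (nat \<Rightarrow> nat) \<Rightarrow> (nat \<Rightarrow> nat) \<Rightarrow> bool" where
  "strip p kap nu = (if p then vstrip kap nu else hstrip kap nu)"

text \<open>Cells of a vertical strip lie in distinct rows; transposition puts them in distinct
  columns, which is the interlacing condition.\<close>

lemma hstrip_conj_iff:
  assumes "is_part kap" "is_part nu"
  shows "hstrip (conj_part kap) (conj_part nu) \<longleftrightarrow> vstrip kap nu"
proof -
  have 1: "(\<forall>c. conj_part kap c \<le> conj_part nu c) \<longleftrightarrow> (\<forall>i. kap i \<le> nu i)"
    unfolding nat_le_less less_conj_part[OF assms(1)] less_conj_part[OF assms(2)] by blast
  have "(\<forall>c. conj_part nu (Suc c) \<le> conj_part kap c) \<longleftrightarrow> (\<forall>i. \<forall>c. Suc c < nu i \<longrightarrow> c < kap i)"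
    unfolding nat_le_less less_conj_part[OF assms(1)] less_conj_part[OF assms(2)] by blast
  also have "\<dots> \<longleftrightarrow> (\<forall>i. nu i \<le> Suc (kap i))"
    by (metis Suc_leI Suc_less_eq less_Suc_eq_le not_less_eq nat_le_less le_refl lessI not_le)
  finally show ?thesis using 1 assms is_part_conj unfolding hstrip_def vstrip_def by blast
qed

lemma strip_part: "strip p kap nu \<Longrightarrow> is_part kap \<and> is_part nu \<and> (\<forall>i. kap i \<le> nu i)"
  by (auto simp: strip_def hstrip_def vstrip_def split: if_splits)

lemma strip_psize: "strip p kap nu \<Longrightarrow> psize kap \<le> psize nu"
  using strip_part psize_mono by metis

lemma is_part_bound2:
  assumes "is_part a" "is_part b"
  obtains n where "\<And>i. i \<ge> n \<Longrightarrow> a i = 0" "\<And>i. i \<ge> n \<Longrightarrow> b i = 0"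
proof -
  obtain x y where "\<And>i. i \<ge> x \<Longrightarrow> a i = 0" "\<And>i. i \<ge> y \<Longrightarrow> b i = 0"
    using assms unfolding is_part_def by auto
  then show ?thesis using that[of "max x y"] by auto
qed

text \<open>With \<open>a = max lam mu\<close> and \<open>b = min lam mu\<close>, both \<open>nu (Suc i)\<close> and \<open>kap i\<close> range over the
  interval from \<open>a (Suc i)\<close> to \<open>b i\<close>; the bijection reflects this interval, and \<open>m\<close> is the
  excess of \<open>nu 0\<close> over \<open>a 0\<close>.\<close>

lemma local_hh:
  assumes la: "is_part lam" and mu: "is_part mu"
  shows "weq {nu. hstrip lam nu \<and> hstrip mu nu} psize
    (UNIV \<times> {kap. hstrip kap lam \<and> hstrip kap mu})
    (\<lambda>(m, kap). psize lam + psize mu + m - psize kap)"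
proof -
  define a where "a i = max (lam i) (mu i)" for i
  define b where "b i = min (lam i) (mu i)" for i
  have ab: "a (Suc i) \<le> b i" if "hstrip lam nu \<and> hstrip mu nu \<or> hstrip nu lam \<and> hstrip nu mu" for i nu
  proof -
    have "lam (Suc i) \<le> lam i" "mu (Suc i) \<le> mu i" using la mu unfolding is_part_def by auto
    moreover have "lam (Suc i) \<le> mu i \<and> mu (Suc i) \<le> lam i"
      using that unfolding hstrip_def by (meson le_trans)
    ultimately show ?thesis by (auto simp: a_def b_def)
  qed
  have nu_iff: "hstrip lam nu \<and> hstrip mu nu \<longleftrightarrow> is_part nu \<and> a 0 \<le> nu 0 \<and>
     (\<forall>i. a (Suc i) \<le> nu (Suc i) \<and> nu (Suc i) \<le> b i)" for nu
  proof -
    have "(\<forall>i. P i) \<longleftrightarrow> P 0 \<and> (\<forall>i. P (Suc i))" for P :: "nat \<Rightarrow> bool" by (metis not0_implies_Suc)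
    from this[of "\<lambda>i. a i \<le> nu i"] show ?thesis
      using la mu by (auto simp: hstrip_def a_def b_def)
  qed
  have kap_iff: "hstrip kap lam \<and> hstrip kap mu \<longleftrightarrow> is_part kap \<and>
     (\<forall>i. a (Suc i) \<le> kap i \<and> kap i \<le> b i)" for kap
    using la mu by (auto simp: hstrip_def a_def b_def)
  obtain n where n: "\<And>i. i \<ge> n \<Longrightarrow> lam i = 0" "\<And>i. i \<ge> n \<Longrightarrow> mu i = 0"
    using is_part_bound2[OF la mu] by blast
  have n': "a i = 0" "b i = 0" if "i \<ge> n" for i using n that by (auto simp: a_def b_def)
  \<comment> \<open>Neighbouring intervals are ordered, since
    \<open>b (Suc i) \<le> a (Suc i)\<close>. Any choice of one point per interval is thus weakly
    decreasing, and the reflection can act on each interval independently.\<close>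
  have bl: "b i \<le> a i" for i by (simp add: a_def b_def)
  have sab: "a i + b i = lam i + mu i" for i by (simp add: a_def b_def max_def min_def)
  define f where "f = (\<lambda>(m, kap). case_nat (a 0 + m) (\<lambda>i. a (Suc i) + b i - kap i) :: nat \<Rightarrow> nat)"
  define g where "g = (\<lambda>nu. (nu 0 - a 0, \<lambda>i. a (Suc i) + b i - nu (Suc i)) :: nat \<times> (nat \<Rightarrow> nat))"
  have A: "g nu \<in> UNIV \<times> {kap. hstrip kap lam \<and> hstrip kap mu} \<and> f (g nu) = nu \<and>
     (case g nu of (m, kap) \<Rightarrow> psize lam + psize mu + m - psize kap) = psize nu"
    if nu: "nu \<in> {nu. hstrip lam nu \<and> hstrip mu nu}" for nu
  proof -
    have ab': "\<And>i. a (Suc i) \<le> b i" using ab nu by blast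
    have nu': "is_part nu" "a 0 \<le> nu 0" "\<And>i. a (Suc i) \<le> nu (Suc i)" "\<And>i. nu (Suc i) \<le> b i"
      using nu nu_iff by auto
    define kap where "kap i = a (Suc i) + b i - nu (Suc i)" for i
    have k1: "a (Suc i) \<le> kap i" "kap i \<le> b i" for i using nu'(3,4)[of i] by (auto simp: kap_def)
    have k2: "is_part kap" unfolding is_part_def
    proof
      show "\<forall>j. kap (Suc j) \<le> kap j" using k1 ab' bl by (meson le_trans)
      show "\<exists>r. \<forall>j\<ge>r. kap j = 0" using k1 n' by (metis le_zero_eq)
    qed
    have gnu: "g nu = (nu 0 - a 0, kap)" by (simp add: g_def kap_def[abs_def])
    have f: "f (g nu) = nu"
    proof
      fix i show "f (g nu) i = nu i"
        using nu'(2) nu'(3,4)[of "i - 1"] unfolding gnu f_def by (cases i) (auto simp: kap_def)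
    qed
    \<comment> \<open>\<open>nu\<close> can have one row more than \<open>lam\<close> and
      \<open>mu\<close>, hence \<open>Suc n\<close>.\<close>
    have nn: "nu i = 0" if "i \<ge> Suc n" for i
      using nu'(4)[of "i - 1"] n'(2)[of "i - 1"] that by (cases i) auto
    have kn: "kap i = 0" if "i \<ge> n" for i using k1(2)[of i] n'(2)[OF that] by simp
    have s: "kap i + nu (Suc i) = a (Suc i) + b i" for i using nu'(3,4)[of i] by (simp add: kap_def)
    \<comment> \<open>The reflection fixes \<open>kap i + nu (Suc i) = a (Suc i) + b i\<close>;
      together with row 0 this sums to the sizes of \<open>lam\<close> and \<open>mu\<close> plus
      the excess of row 0.\<close>
    have "psize kap + psize nu = nu 0 + (\<Sum>i<n. kap i + nu (Suc i))"
      by (simp add: psize_eq[of n kap, OF kn] psize_eq[of "Suc n" nu, OF nn] sum.lessThan_Suc_shift sum.distrib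
         del: sum.lessThan_Suc)
    also have "\<dots> = (nu 0 - a 0) + (a 0 + (\<Sum>i<n. a (Suc i))) + (\<Sum>i<n. b i)" using nu'(2) by (simp add: s sum.distrib)
    also have "a 0 + (\<Sum>i<n. a (Suc i)) = (\<Sum>i<Suc n. a i)" by (rule sum.lessThan_Suc_shift[symmetric])
    also have "\<dots> = (\<Sum>i<n. a i)" using n' by simp
    also have "(nu 0 - a 0) + (\<Sum>i<n. a i) + (\<Sum>i<n. b i) = (nu 0 - a 0) + (\<Sum>i<n. a i + b i)" by (simp add: sum.distrib)
    also have "\<dots> = (nu 0 - a 0) + psize lam + psize mu"
      by (simp add: sab psize_eq[of n, OF n(1)] psize_eq[of n, OF n(2)] sum.distrib)
    finally have "psize lam + psize mu + (nu 0 - a 0) - psize kap = psize nu" by simp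
    then show ?thesis using f k1 k2 kap_iff gnu by auto
  qed
  have B: "f y \<in> {nu. hstrip lam nu \<and> hstrip mu nu} \<and> g (f y) = y"
    if y: "y \<in> UNIV \<times> {kap. hstrip kap lam \<and> hstrip kap mu}" for y
  proof -
    obtain m kap where [simp]: "y = (m, kap)" by (cases y)
    have ab': "\<And>i. a (Suc i) \<le> b i" using ab y by auto
    have k: "is_part kap" "\<And>i. a (Suc i) \<le> kap i" "\<And>i. kap i \<le> b i" using y kap_iff by auto
    define nu where "nu = f y"
    have nu0: "nu 0 = a 0 + m" and nuS: "\<And>i. nu (Suc i) = a (Suc i) + b i - kap i" by (auto simp: nu_def f_def)
    have n1: "a 0 \<le> nu 0" "\<And>i. a (Suc i) \<le> nu (Suc i)" "\<And>i. nu (Suc i) \<le> b i"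
    proof -
      fix i show "a (Suc i) \<le> nu (Suc i)" "nu (Suc i) \<le> b i"
        using nuS[of i] k(2,3)[of i] by linarith+
    qed (simp add: nu0)
    have n2: "is_part nu" unfolding is_part_def
    proof
      have "nu (Suc j) \<le> nu j" for j
        using n1 bl by (cases j) (metis le_trans)+
      then show "\<forall>j. nu (Suc j) \<le> nu j" by blast
      have "nu j = 0" if "j \<ge> Suc n" for j
        using n1(3)[of "j - 1"] n'(2)[of "j - 1"] that by (cases j) auto
      then show "\<exists>r. \<forall>j\<ge>r. nu j = 0" by blast
    qed
    have "g nu = y" using nu0 nuS k(2,3) by (auto simp: g_def fun_eq_iff le_add_diff_inverse diff_diff_right trans_le_add2)
    then show ?thesis using n1 n2 nu_iff nu_def by auto
  qed
  show ?thesis by (rule weqI[of _ g _ f]) (use A B in auto)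
qed

text \<open>Transposition preserves size and exchanges the two kinds of strips, so this is
  \<open>local_hh\<close> for the conjugate shapes.\<close>

lemma local_vv:
  assumes la: "is_part lam" and mu: "is_part mu"
  shows "weq {nu. vstrip lam nu \<and> vstrip mu nu} psize
    (UNIV \<times> {kap. vstrip kap lam \<and> vstrip kap mu})
    (\<lambda>(m, kap). psize lam + psize mu + m - psize kap)"
proof -
  have vp: "vstrip a b \<Longrightarrow> is_part a \<and> is_part b" for a b by (auto simp: vstrip_def)
  have hp: "hstrip a b \<Longrightarrow> is_part a \<and> is_part b" for a b by (auto simp: hstrip_def)
  have hc: "hstrip a b \<Longrightarrow> vstrip (conj_part a) (conj_part b)" for a b
    using hp[of a b] hstrip_conj_iff[of "conj_part a" "conj_part b"] by (simp add: conj_conj is_part_conj)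
  have vc: "vstrip a b \<Longrightarrow> hstrip (conj_part a) (conj_part b)" for a b
    using vp[of a b] hstrip_conj_iff by blast
  note cc = conj_conj[OF la] conj_conj[OF mu]
  let ?w = "\<lambda>(m, kap). psize lam + psize mu + m - psize kap"
  have "weq {nu. vstrip lam nu \<and> vstrip mu nu} psize
     {nu. hstrip (conj_part lam) nu \<and> hstrip (conj_part mu) nu} psize"
  proof (rule weqI[where h = conj_part and h' = conj_part])
    fix nu assume "nu \<in> {nu. vstrip lam nu \<and> vstrip mu nu}"
    then show "conj_part nu \<in> {nu. hstrip (conj_part lam) nu \<and> hstrip (conj_part mu) nu} \<and>
      conj_part (conj_part nu) = nu \<and> psize (conj_part nu) = psize nu"
      using vc vp[of lam nu] by (simp add: conj_conj psize_conj)
  next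
    fix nu assume "nu \<in> {nu. hstrip (conj_part lam) nu \<and> hstrip (conj_part mu) nu}"
    then show "conj_part nu \<in> {nu. vstrip lam nu \<and> vstrip mu nu} \<and> conj_part (conj_part nu) = nu"
      using hc[of "conj_part lam" nu] hc[of "conj_part mu" nu] hp[of _ nu] cc by (auto simp: conj_conj)
  qed
  also have "weq {nu. hstrip (conj_part lam) nu \<and> hstrip (conj_part mu) nu} psize
    (UNIV \<times> {kap. hstrip kap (conj_part lam) \<and> hstrip kap (conj_part mu)}) ?w"
    using local_hh[OF is_part_conj[OF la] is_part_conj[OF mu]] by (simp add: psize_conj la mu)
  also have "weq (UNIV \<times> {kap. hstrip kap (conj_part lam) \<and> hstrip kap (conj_part mu)}) ?w
    (UNIV \<times> {kap. vstrip kap lam \<and> vstrip kap mu}) ?w"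
  proof (rule weqI[where h = "map_prod id conj_part" and h' = "map_prod id conj_part"])
    fix y :: "nat \<times> (nat \<Rightarrow> nat)" assume y: "y \<in> UNIV \<times> {kap. hstrip kap (conj_part lam) \<and> hstrip kap (conj_part mu)}"
    obtain m kap where [simp]: "y = (m, kap)" by (cases y)
    show "map_prod id conj_part y \<in> UNIV \<times> {kap. vstrip kap lam \<and> vstrip kap mu} \<and>
      map_prod id conj_part (map_prod id conj_part y) = y \<and> ?w (map_prod id conj_part y) = ?w y"
      using y hc[of kap "conj_part lam"] hc[of kap "conj_part mu"] hp[of kap] cc by (auto simp: conj_conj psize_conj)
  next
    fix y :: "nat \<times> (nat \<Rightarrow> nat)" assume y: "y \<in> UNIV \<times> {kap. vstrip kap lam \<and> vstrip kap mu}"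
    obtain m kap where [simp]: "y = (m, kap)" by (cases y)
    show "map_prod id conj_part y \<in> UNIV \<times> {kap. hstrip kap (conj_part lam) \<and> hstrip kap (conj_part mu)} \<and>
      map_prod id conj_part (map_prod id conj_part y) = y"
      using y vc[of kap lam] vc[of kap mu] vp[of kap] by (auto simp: conj_conj)
  qed
  finally show ?thesis .
qed

text \<open>Here every row of \<open>nu\<close>, and every row of \<open>kap\<close>, has at most two possible lengths. The rows with
  a genuine choice form the sets \<open>I\<close> for \<open>nu\<close> and \<open>J\<close> for \<open>kap\<close>, and \<open>I\<close> has exactly one
  element more than \<open>J\<close>.\<close>

lemma local_hv:
  assumes la: "is_part lam" and mu: "is_part mu"
  shows "weq {nu. hstrip lam nu \<and> vstrip mu nu} psize
    ({0, 1} \<times> {kap. vstrip kap lam \<and> hstrip kap mu})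
    (\<lambda>(m, kap). psize lam + psize mu + m - psize kap)"
proof (cases "\<forall>i. lam i \<le> Suc (mu i) \<and> mu (Suc i) \<le> lam i")
  \<comment> \<open>A peak and a valley each force both inequalities. When one fails, both sides are
    empty and any function is a bijection.\<close>
  case False
  have "\<not> (hstrip lam nu \<and> vstrip mu nu)" for nu
    using False unfolding hstrip_def vstrip_def by (meson le_trans)
  moreover have "\<not> (vstrip kap lam \<and> hstrip kap mu)" for kap
    using False unfolding hstrip_def vstrip_def by (meson le_trans Suc_le_mono)
  ultimately show ?thesis by (intro weqI[where h = undefined and h' = undefined]) blast+
next
  case True
  then have C: "\<And>i. lam i \<le> Suc (mu i)" "\<And>i. mu (Suc i) \<le> lam i" by auto
  have dec: "lam (Suc i) \<le> lam i" "mu (Suc i) \<le> mu i" for i using la mu by (auto simp: is_part_def)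
  obtain n where n: "\<And>i. i \<ge> n \<Longrightarrow> lam i = 0" "\<And>i. i \<ge> n \<Longrightarrow> mu i = 0"
    using is_part_bound2[OF la mu] by blast
  define a where "a i = max (lam i) (mu i)" for i
  define b where "b i = min (lam i) (mu i)" for i
  define I where "I = {i. (i = 0 \<or> mu i < lam (i - 1)) \<and> lam i \<le> mu i}"
  define J where "J = {i. lam i \<le> mu i \<and> mu (Suc i) < lam i}"
  \<comment> \<open>\<open>I\<close> and \<open>J\<close> both arise by removing the rows
    \<open>V\<close>, where \<open>lam i = Suc (mu i)\<close> forces \<open>nu\<close> and
    \<open>kap\<close>. For \<open>J\<close> they are removed from \<open>D\<close>, for
    \<open>I\<close> from \<open>D\<close> shifted by one row and enlarged by row 0: this is the
    source of the extra element.\<close>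
  define D where "D = {i. mu (Suc i) < lam i}"
  define V where "V = {i. mu i < lam i}"
  have an: "a i = 0" "b i = 0" if "i \<ge> n" for i using n that by (auto simp: a_def b_def)
  have sab: "psize a + psize b = psize lam + psize mu"
  proof -
    have "psize a + psize b = (\<Sum>i<n. a i + b i)"
      by (simp add: psize_eq[of n] an sum.distrib)
    also have "\<dots> = (\<Sum>i<n. lam i + mu i)" by (rule sum.cong) (auto simp: a_def b_def max_def min_def)
    also have "\<dots> = psize lam + psize mu" using psize_eq[of n, OF n(1)] psize_eq[of n, OF n(2)] by (simp add: sum.distrib)
    finally show ?thesis .
  qed
  have Dfin: "finite D" by (rule finite_subset[of _ "{..<n}"]) (use n in \<open>auto simp: D_def intro: ccontr simp: not_less\<close>)
  have VD: "V \<subseteq> D" unfolding V_def D_def using dec le_less_trans by blast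
  have VD': "V \<subseteq> insert 0 (Suc ` D)"
  proof
    fix i assume "i \<in> V" then show "i \<in> insert 0 (Suc ` D)"
      using dec(1)[of "i - 1"] by (cases i) (auto simp: V_def D_def)
  qed
  have Jeq: "J = D - V" by (auto simp: J_def D_def V_def)
  have Ieq: "I = insert 0 (Suc ` D) - V"
  proof (rule set_eqI)
    fix i show "i \<in> I \<longleftrightarrow> i \<in> insert 0 (Suc ` D) - V"
      by (cases i) (auto simp: I_def D_def V_def)
  qed
  have fin: "finite I" "finite J" "finite V" using Dfin Ieq Jeq VD finite_subset by auto
  have cardI: "card I = Suc (card J)"
  proof -
    have "card (insert 0 (Suc ` D)) = Suc (card D)" using Dfin by (simp add: card_image)
    moreover have "card V \<le> card D" by (rule card_mono[OF Dfin VD])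
    ultimately show ?thesis unfolding Ieq Jeq
      by (simp add: card_Diff_subset[OF fin(3) VD] card_Diff_subset[OF fin(3) VD'] Suc_diff_le)
  qed
  \<comment> \<open>Where \<open>lam i \<le> mu i\<close>, row \<open>i\<close> of \<open>nu\<close>
    may exceed \<open>a i = mu i\<close> by one exactly if \<open>lam (i - 1)\<close> leaves room;
    in row 0 there is no such bound.\<close>
  have 1: "weq {nu. hstrip lam nu \<and> vstrip mu nu} psize (Pow I) (\<lambda>E. psize a + card E)"
  proof (rule weq_sym, rule weqI[where h = "\<lambda>E i. a i + (if i \<in> E then 1 else 0)" and h' = "\<lambda>nu. {i. a i < nu i}"])
    fix E assume "E \<in> Pow I"
    then have E: "\<And>i. i \<in> E \<Longrightarrow> (i = 0 \<or> mu i < lam (i - 1)) \<and> lam i \<le> mu i" and EI: "E \<subseteq> I" by (auto simp: I_def)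
    define nu where "nu i = a i + (if i \<in> E then 1 else 0)" for i
    have nu1: "lam i \<le> nu i" "mu i \<le> nu i" "nu i \<le> Suc (mu i)" "nu (Suc i) \<le> lam i" for i
      using C(1)[of i] C(2)[of i] E[of i] E[of "Suc i"] dec[of i] by (auto simp: nu_def a_def)
    have nn: "nu i = 0" if "i \<ge> Suc n" for i using nu1(4)[of "i - 1"] n(1)[of "i - 1"] that by (cases i) auto
    have "is_part nu" unfolding is_part_def using nu1 nn by (meson le_trans)
    then have s: "hstrip lam nu \<and> vstrip mu nu" using nu1 la mu by (simp add: hstrip_def vstrip_def)
    have "i \<le> n" if "i \<in> E" for i using nu1(4)[of "i - 1"] n(1)[of "i - 1"] that E[of i] by (cases i) (auto simp: intro: ccontr)
    then have En: "E \<subseteq> {..<Suc n}" by (auto simp: less_Suc_eq_le)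
    have "psize nu = (\<Sum>i<Suc n. a i) + (\<Sum>i<Suc n. if i \<in> E then 1 else 0)"
      by (subst psize_eq[of "Suc n" nu, OF nn]) (auto simp: nu_def sum.distrib)
    also have "(\<Sum>i<Suc n. a i) = psize a" by (rule psize_eq[symmetric]) (use an in auto)
    also have "(\<Sum>i<Suc n. if i \<in> E then 1 else 0) = card E"
      using En by (simp add: sum.If_cases Int_absorb1 del: sum.lessThan_Suc)
    finally show "(\<lambda>i. a i + (if i \<in> E then 1 else 0)) \<in> {nu. hstrip lam nu \<and> vstrip mu nu} \<and>
      {i. a i < a i + (if i \<in> E then 1 else 0)} = E \<and>
      psize (\<lambda>i. a i + (if i \<in> E then 1 else 0)) = psize a + card E"
      using s by (auto simp: nu_def[abs_def])
  next
    fix nu assume "nu \<in> {nu. hstrip lam nu \<and> vstrip mu nu}"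
    then have nu: "\<And>i. lam i \<le> nu i" "\<And>i. nu (Suc i) \<le> lam i" "\<And>i. mu i \<le> nu i" "\<And>i. nu i \<le> Suc (mu i)"
      by (auto simp: hstrip_def vstrip_def)
    have "i \<in> I" if "a i < nu i" for i
      using that nu(1,3,4)[of i] nu(2)[of "i - 1"] unfolding I_def a_def by (cases i) auto
    moreover have "a i + (if i \<in> {i. a i < nu i} then 1 else 0) = nu i" for i
      using nu(1,3,4)[of i] by (auto simp: a_def)
    ultimately show "{i. a i < nu i} \<in> Pow I \<and> (\<lambda>i. a i + (if i \<in> {i. a i < nu i} then 1 else 0)) = nu" by auto
  qed
  \<comment> \<open>Cells are removed from \<open>b\<close>, so the weight falls as \<open>F\<close>
    grows; integers avoid truncated subtraction.\<close>
  have 2: "weq (Pow J) (\<lambda>F. int (psize b) - int (card F)) {kap. vstrip kap lam \<and> hstrip kap mu} (\<lambda>kap. int (psize kap))"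
  proof (rule weqI[where h = "\<lambda>F i. b i - (if i \<in> F then 1 else 0)" and h' = "\<lambda>kap. {i. kap i < b i}"])
    fix F assume "F \<in> Pow J"
    then have F: "\<And>i. i \<in> F \<Longrightarrow> lam i \<le> mu i \<and> mu (Suc i) < lam i" and FJ: "F \<subseteq> J" by (auto simp: J_def)
    define kap where "kap i = b i - (if i \<in> F then 1 else 0)" for i
    have bF: "b i > 0" if "i \<in> F" for i using F[OF that] by (auto simp: b_def)
    have k1: "kap i \<le> lam i" "kap i \<le> mu i" "lam i \<le> Suc (kap i)" "mu (Suc i) \<le> kap i" for i
      using C(1)[of i] C(2)[of i] F[of i] dec[of i] by (auto simp: kap_def b_def)
    have kn: "kap i = 0" if "i \<ge> n" for i using k1(1)[of i] n(1)[of "i"] that by auto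
    have "is_part kap" unfolding is_part_def using k1 kn by (meson le_trans)
    then have s: "vstrip kap lam \<and> hstrip kap mu" using k1 la mu by (simp add: hstrip_def vstrip_def)
    have "i < n" if "i \<in> F" for i using bF[OF that] an(2)[of i] by (auto intro: ccontr simp: not_less)
    then have Fn: "F \<subseteq> {..<n}" by auto
    have "psize kap + card F = (\<Sum>i<n. kap i) + (\<Sum>i<n. if i \<in> F then 1 else 0)"
      using Fn psize_eq[of n kap, OF kn] by (simp add: sum.If_cases Int_absorb1)
    also have "\<dots> = (\<Sum>i<n. b i)" unfolding sum.distrib[symmetric] by (rule sum.cong) (use bF in \<open>auto simp: kap_def\<close>)
    also have "\<dots> = psize b" by (rule psize_eq[symmetric]) (use an in auto)
    finally show "(\<lambda>i. b i - (if i \<in> F then 1 else 0)) \<in> {kap. vstrip kap lam \<and> hstrip kap mu} \<and>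
      {i. b i - (if i \<in> F then 1 else 0) < b i} = F \<and>
      int (psize (\<lambda>i. b i - (if i \<in> F then 1 else 0))) = int (psize b) - int (card F)"
      using s bF by (auto simp: kap_def[abs_def])
  next
    fix kap assume "kap \<in> {kap. vstrip kap lam \<and> hstrip kap mu}"
    then have k: "\<And>i. kap i \<le> lam i" "\<And>i. lam i \<le> Suc (kap i)" "\<And>i. kap i \<le> mu i" "\<And>i. mu (Suc i) \<le> kap i"
      by (auto simp: hstrip_def vstrip_def)
    have "i \<in> J" if "kap i < b i" for i
      using that k[of i] unfolding J_def b_def by auto
    moreover have "b i - (if i \<in> {i. kap i < b i} then 1 else 0) = kap i" for i
      using k[of i] by (auto simp: b_def)
    ultimately show "{i. kap i < b i} \<in> Pow J \<and> (\<lambda>i. b i - (if i \<in> {i. kap i < b i} then 1 else 0)) = kap" by auto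
  qed
  \<comment> \<open>A dummy element makes \<open>J\<close> as large as \<open>I\<close>; whether it
    is chosen becomes the multiplicity \<open>m\<close>.\<close>
  obtain z where z: "z \<notin> J" using fin(2) by (metis ex_new_if_finite infinite_UNIV_nat)
  have "weq (Pow I) card ({0, 1} \<times> Pow J) (\<lambda>(m, F). m + card F)"
    by (rule weq_trans[OF weq_Pow weq_Pow_insert]) (use fin z cardI in auto)
  then have 3: "weq (Pow I) (\<lambda>E. psize a + card E) ({0, 1} \<times> Pow J) (\<lambda>(m, F). psize a + m + card F)"
    by (rule weq_weight) auto
  have "weq ({0, 1::nat} \<times> Pow J) (\<lambda>(m, F). (m, int (psize b) - int (card F)))
    ({0, 1} \<times> {kap. vstrip kap lam \<and> hstrip kap mu}) (\<lambda>(m, kap). (m, int (psize kap)))"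
    by (rule weq_Sigma, rule weq_weight[OF 2]) auto
  then have 4: "weq ({0, 1} \<times> Pow J) (\<lambda>(m, F). psize a + m + card F)
    ({0, 1} \<times> {kap. vstrip kap lam \<and> hstrip kap mu}) (\<lambda>(m, kap). psize lam + psize mu + m - psize kap)"
  proof (rule weq_weight[where F = "\<lambda>(m, k). nat (int (psize lam + psize mu + m) - k)"])
    fix x :: "nat \<times> nat set" assume "x \<in> {0, 1} \<times> Pow J"
    then show "(case x of (m, F) \<Rightarrow> psize a + m + card F) =
      (case case x of (m, F) \<Rightarrow> (m, int (psize b) - int (card F)) of (m, k) \<Rightarrow> nat (int (psize lam + psize mu + m) - k))"
      using sab by auto
  qed auto
  show ?thesis by (rule weq_trans[OF weq_trans[OF 1 3] 4])
qed

text \<open>The exponents occurring in \<open>1 + z\<close> (for \<open>True\<close>) or in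
  \<open>1 / (1 - z)\<close>: the multiplicities possible for two steps of different or of equal
  type.\<close>

definition bits :: "bool \<Rightarrow> nat set" where
  "bits b = (if b then {0, 1} else UNIV)"

text \<open>With \<open>lam\<close> and \<open>mu\<close> fixed, \<open>psize nu\<close> alone
  determines both strip sizes. Opposite sides of the square carry the same letter, and the excess
  \<open>m\<close> enlarges both strips of the peak, hence the weight \<open>X + Y\<close>.\<close>

lemma strip_local:
  fixes X Y :: "'w :: comm_semiring_1"
  assumes la: "is_part lam" and mu: "is_part mu"
  shows "weq {nu. strip p lam nu \<and> strip q mu nu}
      (\<lambda>nu. of_nat (psize nu - psize mu) * X + of_nat (psize nu - psize lam) * Y)
    (bits (q \<noteq> p) \<times> {kap. strip q kap lam \<and> strip p kap mu})
      (\<lambda>(m, kap). of_nat (psize lam - psize kap) * X + of_nat (psize mu - psize kap) * Y + of_nat m * (X + Y))"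
proof -
  have "weq {nu. strip p lam nu \<and> strip q mu nu} psize
    (bits (q \<noteq> p) \<times> {kap. strip q kap lam \<and> strip p kap mu})
    (\<lambda>(m, kap). psize lam + psize mu + m - psize kap)"
    using local_hh[OF la mu] local_vv[OF la mu] local_hv[OF la mu] local_hv[OF mu la]
    by (cases p; cases q) (simp_all add: strip_def bits_def conj_commute add_ac)
  then show ?thesis
  proof (rule weq_weight)
    fix y assume "y \<in> bits (q \<noteq> p) \<times> {kap. strip q kap lam \<and> strip p kap mu}"
    then obtain m kap where [simp]: "y = (m, kap)" and k: "psize kap \<le> psize lam" "psize kap \<le> psize mu"
      using strip_psize by blast
    have "psize lam + psize mu + m - psize kap - psize mu = (psize lam - psize kap) + m"
      "psize lam + psize mu + m - psize kap - psize lam = (psize mu - psize kap) + m" using k by auto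
    then show "(case y of (m, kap) \<Rightarrow> of_nat (psize lam - psize kap) * X + of_nat (psize mu - psize kap) * Y + of_nat m * (X + Y)) =
      of_nat ((case y of (m, kap) \<Rightarrow> psize lam + psize mu + m - psize kap) - psize mu) * X +
      of_nat ((case y of (m, kap) \<Rightarrow> psize lam + psize mu + m - psize kap) - psize lam) * Y"
      by (simp add: algebra_simps)
  qed auto
qed

section \<open>The super Cauchy identity\<close>

lemma weq_PiE_Un:
  fixes W :: "'i \<Rightarrow> 'w :: comm_semiring_1"
  assumes "finite F" "finite G" "F \<inter> G = {}"
  shows "weq (PiE F S \<times> PiE G S)
      (\<lambda>(r, r'). (\<Sum>z\<in>F. of_nat (r z) * W z) + (\<Sum>z\<in>G. of_nat (r' z) * W z))
    (PiE (F \<union> G) S) (\<lambda>r. \<Sum>z\<in>F \<union> G. of_nat (r z) * W z)"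
proof (rule weqI[where h = "\<lambda>(r, r') z. if z \<in> F then r z else r' z" and h' = "\<lambda>r. (restrict r F, restrict r G)"])
  fix x assume x: "x \<in> PiE F S \<times> PiE G S"
  obtain r r' where [simp]: "x = (r, r')" and r: "r \<in> PiE F S" "r' \<in> PiE G S" using x by (cases x) auto
  let ?h = "\<lambda>z. if z \<in> F then r z else r' z"
  have "?h \<in> PiE (F \<union> G) S" using r by (auto simp: PiE_def extensional_def)
  moreover have "restrict ?h F = r"
    by (rule extensionalityI[of _ F]) (use r in \<open>auto simp: PiE_iff\<close>)
  moreover have "restrict ?h G = r'"
    by (rule extensionalityI[of _ G]) (use r assms(3) in \<open>auto simp: PiE_iff\<close>)
  moreover have "(\<Sum>z\<in>F \<union> G. of_nat (?h z) * W z) = (\<Sum>z\<in>F. of_nat (?h z) * W z) + (\<Sum>z\<in>G. of_nat (?h z) * W z)"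
    by (rule sum.union_disjoint[OF assms])
  moreover have "(\<Sum>z\<in>F. of_nat (?h z) * W z) = (\<Sum>z\<in>F. of_nat (r z) * W z)"
    by (rule sum.cong) auto
  moreover have "(\<Sum>z\<in>G. of_nat (?h z) * W z) = (\<Sum>z\<in>G. of_nat (r' z) * W z)"
    by (rule sum.cong) (use assms(3) in auto)
  ultimately show "(case x of (r, r') \<Rightarrow> \<lambda>z. if z \<in> F then r z else r' z) \<in> PiE (F \<union> G) S \<and>
     (restrict (case x of (r, r') \<Rightarrow> \<lambda>z. if z \<in> F then r z else r' z) F,
      restrict (case x of (r, r') \<Rightarrow> \<lambda>z. if z \<in> F then r z else r' z) G) = x \<and>
     (\<Sum>z\<in>F \<union> G. of_nat ((case x of (r, r') \<Rightarrow> \<lambda>z. if z \<in> F then r z else r' z) z) * W z) =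
     (case x of (r, r') \<Rightarrow> (\<Sum>z\<in>F. of_nat (r z) * W z) + (\<Sum>z\<in>G. of_nat (r' z) * W z))"
    by simp
next
  fix r assume "r \<in> PiE (F \<union> G) S"
  then show "(restrict r F, restrict r G) \<in> PiE F S \<times> PiE G S \<and>
     (case (restrict r F, restrict r G) of (r, r') \<Rightarrow> \<lambda>z. if z \<in> F then r z else r' z) = r"
    by (auto simp: fun_eq_iff PiE_def extensional_def)
qed

lemma weq_PiE_insert:
  fixes W :: "'i \<Rightarrow> 'w :: comm_semiring_1"
  assumes "finite F" "z \<notin> F"
  shows "weq (S z \<times> PiE F S) (\<lambda>(m, r). of_nat m * W z + (\<Sum>z\<in>F. of_nat (r z) * W z))
    (PiE (insert z F) S) (\<lambda>r. \<Sum>z\<in>insert z F. of_nat (r z) * W z)"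
proof (rule weqI[where h = "\<lambda>(m, r). r(z := m)" and h' = "\<lambda>r. (r z, restrict r F)"])
  fix x assume x: "x \<in> S z \<times> PiE F S"
  obtain m r where [simp]: "x = (m, r)" and r: "m \<in> S z" "r \<in> PiE F S" using x by (cases x) auto
  have "r(z := m) \<in> PiE (insert z F) S" using r by (auto simp: PiE_def extensional_def)
  moreover have "restrict (r(z := m)) F = r"
    by (rule extensionalityI[of _ F]) (use r assms(2) in \<open>auto simp: PiE_iff\<close>)
  moreover have "(\<Sum>z'\<in>F. of_nat ((r(z := m)) z') * W z') = (\<Sum>z\<in>F. of_nat (r z) * W z)"
    by (rule sum.cong) (use assms in auto)
  ultimately show "(case x of (m, r) \<Rightarrow> r(z := m)) \<in> PiE (insert z F) S \<and>
     ((case x of (m, r) \<Rightarrow> r(z := m)) z, restrict (case x of (m, r) \<Rightarrow> r(z := m)) F) = x \<and>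
     (\<Sum>za\<in>insert z F. of_nat ((case x of (m, r) \<Rightarrow> r(z := m)) za) * W za) =
     (case x of (m, r) \<Rightarrow> of_nat m * W z + (\<Sum>z\<in>F. of_nat (r z) * W z))"
    using assms by simp
next
  fix r assume "r \<in> PiE (insert z F) S"
  then show "(r z, restrict r F) \<in> S z \<times> PiE F S \<and> (case (r z, restrict r F) of (m, r) \<Rightarrow> r(z := m)) = r"
    by (auto simp: fun_eq_iff PiE_def extensional_def)
qed

text \<open>The partitions of a chain are listed from the outermost one inwards, without the outermost shape
  \<open>nu\<close> itself.\<close>

fun tab :: "('a \<Rightarrow> bool) \<Rightarrow> 'a list \<Rightarrow> (nat \<Rightarrow> nat) \<Rightarrow> (nat \<Rightarrow> nat) \<Rightarrow> (nat \<Rightarrow> nat) list set" where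
  "tab p [] lam nu = (if lam = nu then {[]} else {})"
| "tab p (x # xs) lam nu = {kap # c | kap c. strip (p x) kap nu \<and> c \<in> tab p xs lam kap}"

fun tabw :: "('a \<Rightarrow> 'w :: comm_semiring_1) \<Rightarrow> 'a list \<Rightarrow> (nat \<Rightarrow> nat) \<Rightarrow> (nat \<Rightarrow> nat) list \<Rightarrow> 'w" where
  "tabw W (x # xs) nu (kap # c) = of_nat (psize nu - psize kap) * W x + tabw W xs kap c"
| "tabw W _ _ _ = 0"

context
  fixes p :: "'a \<Rightarrow> bool" and q :: "'b \<Rightarrow> bool"
    and X :: "'a \<Rightarrow> 'w :: comm_semiring_1" and Y :: "'b \<Rightarrow> 'w"
begin

definition mats :: "('a \<times> 'b) set \<Rightarrow> ('a \<times> 'b \<Rightarrow> nat) set" where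
  "mats F = PiE F (\<lambda>(a, b). bits (p a \<noteq> q b))"

definition matw :: "('a \<times> 'b) set \<Rightarrow> ('a \<times> 'b \<Rightarrow> nat) \<Rightarrow> 'w" where
  "matw F r = (\<Sum>z\<in>F. of_nat (r z) * (case z of (a, b) \<Rightarrow> X a + Y b))"

text \<open>Moving one step through a chain by successive growth rules splits off one row of the
  matrix of multiplicities.\<close>

lemma strip_across_tab:
  assumes "distinct ys" "is_part lam" "is_part mu"
  shows "weq {(nu, c). strip (p a) mu nu \<and> c \<in> tab q ys lam nu}
      (\<lambda>(nu, c). of_nat (psize nu - psize mu) * X a + tabw Y ys nu c)
    ({(kap, c). strip (p a) kap lam \<and> c \<in> tab q ys kap mu} \<times> mats ({a} \<times> set ys))
      (\<lambda>((kap, c), r). of_nat (psize lam - psize kap) * X a + tabw Y ys mu c + matw ({a} \<times> set ys) r)"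
  using assms
proof (induction ys arbitrary: mu)
  case Nil
  show ?case
    by (rule weqI[where h = "\<lambda>_. ((mu, []), \<lambda>_. undefined)" and h' = "\<lambda>_. (lam, [])"])
      (auto simp: mats_def matw_def split: if_splits)
next
  case (Cons b bs)
  let ?I = "{(nu', c). is_part nu' \<and> c \<in> tab q bs lam nu'}"
  let ?K = "bits (p a \<noteq> q b) \<times> {kap. strip (q b) kap mu}"
  let ?G = "\<lambda>kap. {(kap', c). strip (p a) kap' lam \<and> c \<in> tab q bs kap' kap}"
  let ?w = "\<lambda>m nu' kap. of_nat (psize nu' - psize kap) * X a + of_nat (psize mu - psize kap) * Y b + of_nat m * (X a + Y b)"
  have 1: "weq {(nu, c). strip (p a) mu nu \<and> c \<in> tab q (b # bs) lam nu}
      (\<lambda>(nu, c). of_nat (psize nu - psize mu) * X a + tabw Y (b # bs) nu c)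
    (Sigma ?I (\<lambda>(nu', c). {nu. strip (q b) nu' nu \<and> strip (p a) mu nu}))
      (\<lambda>((nu', c), nu). of_nat (psize nu - psize mu) * X a + of_nat (psize nu - psize nu') * Y b + tabw Y bs nu' c)"
    by (rule weqI[where h = "\<lambda>(nu, c). ((hd c, tl c), nu)" and h' = "\<lambda>((nu', c), nu). (nu, nu' # c)"])
      (auto simp: add_ac dest: strip_part)
  \<comment> \<open>With \<open>nu'\<close> fixed, the peak \<open>nu\<close> over
    \<open>nu'\<close> and \<open>mu\<close> is exchanged for a valley \<open>kap\<close>; the
    multiplicity is the matrix entry at \<open>(a, b)\<close>.\<close>
  have 2: "weq (Sigma ?I (\<lambda>(nu', c). {nu. strip (q b) nu' nu \<and> strip (p a) mu nu}))
      (\<lambda>((nu', c), nu). of_nat (psize nu - psize mu) * X a + of_nat (psize nu - psize nu') * Y b + tabw Y bs nu' c)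
    (Sigma ?I (\<lambda>(nu', c). bits (p a \<noteq> q b) \<times> {kap. strip (p a) kap nu' \<and> strip (q b) kap mu}))
      (\<lambda>((nu', c), (m, kap)). ?w m nu' kap + tabw Y bs nu' c)"
  proof -
    have "weq {nu. strip (q b) nu' nu \<and> strip (p a) mu nu}
        (\<lambda>nu. of_nat (psize nu - psize mu) * X a + of_nat (psize nu - psize nu') * Y b + tabw Y bs nu' c)
      (bits (p a \<noteq> q b) \<times> {kap. strip (p a) kap nu' \<and> strip (q b) kap mu})
        (\<lambda>(m, kap). ?w m nu' kap + tabw Y bs nu' c)" if "is_part nu'" for nu' c
      using strip_local[OF that Cons.prems(3), of "q b" "p a" "X a" "Y b"]
      by (rule weq_weight[where F = "\<lambda>u. u + tabw Y bs nu' c"]) auto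
    then show ?thesis by (intro weq_Sigma_uncurried) auto
  qed
  \<comment> \<open>Reordering the choices makes \<open>kap\<close> the fixed shape. The step of
    \<open>a\<close> now leads from \<open>kap\<close> to \<open>nu'\<close>, which is the situation
    of the induction hypothesis with \<open>kap\<close> in place of \<open>mu\<close>.\<close>
  have 3: "weq (Sigma ?I (\<lambda>(nu', c). bits (p a \<noteq> q b) \<times> {kap. strip (p a) kap nu' \<and> strip (q b) kap mu}))
      (\<lambda>((nu', c), (m, kap)). ?w m nu' kap + tabw Y bs nu' c)
    (Sigma ?K (\<lambda>(m, kap). {(nu', c). strip (p a) kap nu' \<and> c \<in> tab q bs lam nu'}))
      (\<lambda>((m, kap), (nu', c)). ?w m nu' kap + tabw Y bs nu' c)"
    by (rule weqI[where h = prod.swap and h' = prod.swap]) (auto dest: strip_part)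
  have 4: "weq (Sigma ?K (\<lambda>(m, kap). {(nu', c). strip (p a) kap nu' \<and> c \<in> tab q bs lam nu'}))
      (\<lambda>((m, kap), (nu', c)). ?w m nu' kap + tabw Y bs nu' c)
    (Sigma ?K (\<lambda>(m, kap). ?G kap \<times> mats ({a} \<times> set bs)))
      (\<lambda>((m, kap), ((kap', c), r)). of_nat (psize mu - psize kap) * Y b + of_nat m * (X a + Y b) +
        (of_nat (psize lam - psize kap') * X a + tabw Y bs kap c + matw ({a} \<times> set bs) r))"
  proof -
    have "weq {(nu', c). strip (p a) kap nu' \<and> c \<in> tab q bs lam nu'}
        (\<lambda>(nu', c). ?w m nu' kap + tabw Y bs nu' c)
      (?G kap \<times> mats ({a} \<times> set bs))
      (\<lambda>((kap', c), r). of_nat (psize mu - psize kap) * Y b + of_nat m * (X a + Y b) +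
        (of_nat (psize lam - psize kap') * X a + tabw Y bs kap c + matw ({a} \<times> set bs) r))"
      if "is_part kap" for m kap
      by (rule weq_weight[OF Cons.IH[OF _ Cons.prems(2) that],
          where F = "\<lambda>u. of_nat (psize mu - psize kap) * Y b + of_nat m * (X a + Y b) + u"])
        (use Cons.prems in \<open>auto simp: add_ac\<close>)
    then show ?thesis by (intro weq_Sigma_uncurried) (auto dest: strip_part)
  qed
  \<comment> \<open>The strip of \<open>b\<close> between \<open>kap\<close> and \<open>mu\<close>
    is put back in front, so \<open>kap\<close> heads the chain below \<open>mu\<close>.\<close>
  have 5: "weq (Sigma ?K (\<lambda>(m, kap). ?G kap \<times> mats ({a} \<times> set bs)))
      (\<lambda>((m, kap), ((kap', c), r)). of_nat (psize mu - psize kap) * Y b + of_nat m * (X a + Y b) +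
        (of_nat (psize lam - psize kap') * X a + tabw Y bs kap c + matw ({a} \<times> set bs) r))
    ((bits (p a \<noteq> q b) \<times> mats ({a} \<times> set bs)) \<times> {(kap, c). strip (p a) kap lam \<and> c \<in> tab q (b # bs) kap mu})
      (\<lambda>((m, r), (kap', c)). (of_nat m * (X a + Y b) + matw ({a} \<times> set bs) r) +
        (of_nat (psize lam - psize kap') * X a + tabw Y (b # bs) mu c))"
    by (rule weqI[where h = "\<lambda>((m, kap), ((kap', c), r)). ((m, r), (kap', kap # c))" 
      and h' = "\<lambda>((m, r), (kap', c)). ((m, hd c), ((kap', tl c), r))"])
      (auto simp: add_ac)
  have 6: "weq (bits (p a \<noteq> q b) \<times> mats ({a} \<times> set bs)) (\<lambda>(m, r). of_nat m * (X a + Y b) + matw ({a} \<times> set bs) r)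
    (mats ({a} \<times> set (b # bs))) (matw ({a} \<times> set (b # bs)))"
  proof -
    have "{a} \<times> set (b # bs) = insert (a, b) ({a} \<times> set bs)" by auto
    then show ?thesis
      using weq_PiE_insert[of "{a} \<times> set bs" "(a, b)" "\<lambda>(a, b). bits (p a \<noteq> q b)" "\<lambda>(a, b). X a + Y b"] Cons.prems(1)
      by (simp add: mats_def matw_def[abs_def])
  qed
  have 7: "weq ((bits (p a \<noteq> q b) \<times> mats ({a} \<times> set bs)) \<times> {(kap, c). strip (p a) kap lam \<and> c \<in> tab q (b # bs) kap mu})
      (\<lambda>((m, r), (kap', c)). (of_nat m * (X a + Y b) + matw ({a} \<times> set bs) r) +
        (of_nat (psize lam - psize kap') * X a + tabw Y (b # bs) mu c))
    (mats ({a} \<times> set (b # bs)) \<times> {(kap, c). strip (p a) kap lam \<and> c \<in> tab q (b # bs) kap mu})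
      (\<lambda>(r, (kap', c)). matw ({a} \<times> set (b # bs)) r +
        (of_nat (psize lam - psize kap') * X a + tabw Y (b # bs) mu c))"
    using weq_times[OF 6, where F = "\<lambda>u (kap', c). u + (of_nat (psize lam - psize kap') * X a + tabw Y (b # bs) mu c)"]
    by (simp add: case_prod_unfold)
  have 8: "weq (mats ({a} \<times> set (b # bs)) \<times> {(kap, c). strip (p a) kap lam \<and> c \<in> tab q (b # bs) kap mu})
      (\<lambda>(r, (kap', c)). matw ({a} \<times> set (b # bs)) r +
        (of_nat (psize lam - psize kap') * X a + tabw Y (b # bs) mu c))
    ({(kap, c). strip (p a) kap lam \<and> c \<in> tab q (b # bs) kap mu} \<times> mats ({a} \<times> set (b # bs)))
      (\<lambda>((kap, c), r). of_nat (psize lam - psize kap) * X a + tabw Y (b # bs) mu c + matw ({a} \<times> set (b # bs)) r)"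
    by (rule weqI[where h = prod.swap and h' = prod.swap]) (auto simp: add_ac simp del: tabw.simps tab.simps)
  note weq_trans[OF 1 2]
  note weq_trans[OF this 3]
  note weq_trans[OF this 4]
  note weq_trans[OF this 5]
  note weq_trans[OF this 7]
  from weq_trans[OF this 8] show ?case .
qed

lemma strip_empty_iff: "strip t kap (\<lambda>_. 0) \<longleftrightarrow> kap = (\<lambda>_. 0)"
  by (auto simp: strip_def hstrip_def vstrip_def is_part_def)

lemma tab_empty:
  obtains c where "tab q ys (\<lambda>_. 0) (\<lambda>_. 0) = {c}" "tabw Y ys (\<lambda>_. 0) c = 0"
proof (induction ys arbitrary: thesis)
  case (Cons y ys)
  obtain c where "tab q ys (\<lambda>_. 0) (\<lambda>_. 0) = {c}" "tabw Y ys (\<lambda>_. 0) c = 0" using Cons.IH by blast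
  then show ?case by (intro Cons.prems[of "(\<lambda>_. 0) # c"]) (auto simp: strip_empty_iff)
qed simp

text \<open>A step of \<open>xs\<close> carried through the whole \<open>ys\<close> chain ends
  inside the empty shape, where only the trivial strip exists. What remains is a pair of chains for
  the shorter list, with outer shape \<open>mu\<close>, and one row of the matrix.\<close>

lemma super_cauchy:
  assumes "distinct xs" "distinct ys"
  shows "weq (SIGMA nu:Collect is_part. tab p xs (\<lambda>_. 0) nu \<times> tab q ys (\<lambda>_. 0) nu)
      (\<lambda>(nu, (c, d)). tabw X xs nu c + tabw Y ys nu d)
    (mats (set xs \<times> set ys)) (matw (set xs \<times> set ys))"
  using assms(1)
proof (induction xs)
  case Nil
  obtain d where "tab q ys (\<lambda>_. 0) (\<lambda>_. 0) = {d}" "tabw Y ys (\<lambda>_. 0) d = 0" using tab_empty .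
  then show ?case
    by (intro weqI[where h = "\<lambda>_ _. undefined" and h' = "\<lambda>_. (\<lambda>_. 0, ([], d))"])
      (auto simp: mats_def matw_def is_part_def split: if_splits)
next
  case (Cons a as)
  let ?e = "\<lambda>_::nat. 0::nat"
  let ?T = "SIGMA nu:Collect is_part. tab p as ?e nu \<times> tab q ys ?e nu"
  let ?I = "{(mu, c). is_part mu \<and> c \<in> tab p as ?e mu}"
  have e: "is_part ?e" by (simp add: is_part_def)
  have 1: "weq (SIGMA nu:Collect is_part. tab p (a # as) ?e nu \<times> tab q ys ?e nu)
      (\<lambda>(nu, (c, d)). tabw X (a # as) nu c + tabw Y ys nu d)
    (Sigma ?I (\<lambda>(mu, c). {(nu, d). strip (p a) mu nu \<and> d \<in> tab q ys ?e nu}))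
      (\<lambda>((mu, c), (nu, d)). of_nat (psize nu - psize mu) * X a + tabw Y ys nu d + tabw X as mu c)"
    by (rule weqI[where h = "\<lambda>(nu, (c, d)). ((hd c, tl c), (nu, d))" and h' = "\<lambda>((mu, c), (nu, d)). (nu, (mu # c, d))"])
      (auto simp: add_ac dest: strip_part)
  have 2: "weq (Sigma ?I (\<lambda>(mu, c). {(nu, d). strip (p a) mu nu \<and> d \<in> tab q ys ?e nu}))
      (\<lambda>((mu, c), (nu, d)). of_nat (psize nu - psize mu) * X a + tabw Y ys nu d + tabw X as mu c)
    (Sigma ?I (\<lambda>(mu, c). {(kap, d). strip (p a) kap ?e \<and> d \<in> tab q ys kap mu} \<times> mats ({a} \<times> set ys)))
      (\<lambda>((mu, c), ((kap, d), r)). of_nat (psize ?e - psize kap) * X a + tabw Y ys mu d +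
        matw ({a} \<times> set ys) r + tabw X as mu c)"
  proof -
    have "weq {(nu, d). strip (p a) mu nu \<and> d \<in> tab q ys ?e nu}
      (\<lambda>(nu, d). of_nat (psize nu - psize mu) * X a + tabw Y ys nu d + tabw X as mu c)
      ({(kap, d). strip (p a) kap ?e \<and> d \<in> tab q ys kap mu} \<times> mats ({a} \<times> set ys))
      (\<lambda>((kap, d), r). of_nat (psize ?e - psize kap) * X a + tabw Y ys mu d +
        matw ({a} \<times> set ys) r + tabw X as mu c)" if "is_part mu" for mu c
      by (rule weq_weight[OF strip_across_tab[OF assms(2) e that],
            where F = "\<lambda>u. u + tabw X as mu c"]) auto
    then show ?thesis by (intro weq_Sigma_uncurried) auto
  qed
  have 3: "weq (Sigma ?I (\<lambda>(mu, c). {(kap, d). strip (p a) kap ?e \<and> d \<in> tab q ys kap mu} \<times> mats ({a} \<times> set ys)))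
      (\<lambda>((mu, c), ((kap, d), r)). of_nat (psize ?e - psize kap) * X a + tabw Y ys mu d +
        matw ({a} \<times> set ys) r + tabw X as mu c)
    (?T \<times> mats ({a} \<times> set ys)) (\<lambda>((mu, (c, d)), r). tabw X as mu c + tabw Y ys mu d + matw ({a} \<times> set ys) r)"
    by (rule weqI[where h = "\<lambda>((mu, c), ((kap, d), r)). ((mu, (c, d)), r)" 
      and h' = "\<lambda>((mu, (c, d)), r). ((mu, c), ((?e, d), r))"])
      (auto simp: strip_empty_iff add_ac)
  have 4: "weq (?T \<times> mats ({a} \<times> set ys)) (\<lambda>((mu, (c, d)), r). tabw X as mu c + tabw Y ys mu d + matw ({a} \<times> set ys) r)
    (mats (set as \<times> set ys) \<times> mats ({a} \<times> set ys)) (\<lambda>(r', r). matw (set as \<times> set ys) r' + matw ({a} \<times> set ys) r)"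
    using weq_times[OF Cons.IH, where F = "\<lambda>u r. u + matw ({a} \<times> set ys) r"] Cons.prems
    by (simp add: case_prod_unfold)
  have 5: "weq (mats (set as \<times> set ys) \<times> mats ({a} \<times> set ys)) (\<lambda>(r', r). matw (set as \<times> set ys) r' + matw ({a} \<times> set ys) r)
    (mats (set (a # as) \<times> set ys)) (matw (set (a # as) \<times> set ys))"
  proof -
    have "set (a # as) \<times> set ys = set as \<times> set ys \<union> {a} \<times> set ys" by auto
    then show ?thesis unfolding mats_def matw_def[abs_def]
      by (simp only:) (rule weq_PiE_Un, use Cons.prems in auto)
  qed
  note weq_trans[OF 1 2]
  note weq_trans[OF this 3]
  note weq_trans[OF this 4]
  from weq_trans[OF this 5] show ?case .
qed

end

section \<open>Plane partitions as chains of strips\<close>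

text \<open>Lists serve the induction over letters, functions serve the slices of an array. From
  \<open>n\<close> on the chain is constantly empty, so the strip condition can be imposed for all
  \<open>i\<close>.\<close>

lemma tab_chain:
  "weq (tab p (map f [0..<n]) (\<lambda>_. 0) nu) (tabw X (map f [0..<n]) nu)
    {A. A 0 = nu \<and> (\<forall>i. strip (p (f i)) (A (Suc i)) (A i)) \<and> (\<forall>i\<ge>n. A i = (\<lambda>_. 0))}
    (\<lambda>A. \<Sum>i<n. of_nat (psize (A i) - psize (A (Suc i))) * X (f i))"
proof (induction n arbitrary: f nu)
  case 0
  show ?case
    by (rule weqI[where h = "\<lambda>_ _ _. 0" and h' = "\<lambda>_. []"])
      (auto simp: fun_eq_iff strip_empty_iff split: if_splits)
next
  case (Suc n)
  let ?S = "\<lambda>f n nu. {A. A 0 = nu \<and> (\<forall>i. strip (p (f i)) (A (Suc i)) (A i)) \<and> (\<forall>i\<ge>n. A i = (\<lambda>_. 0))}"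
  let ?w = "\<lambda>f n A. \<Sum>i<n. of_nat (psize (A i) - psize (A (Suc i))) * X (f i)"
  let ?g = "\<lambda>i. f (Suc i)"
  let ?K = "{kap. strip (p (f 0)) kap nu}"
  have m: "map f [0..<Suc n] = f 0 # map ?g [0..<n]"
    by (simp add: upt_conv_Cons map_Suc_upt[symmetric] del: upt_Suc)
  have 1: "weq (tab p (map f [0..<Suc n]) (\<lambda>_. 0) nu) (tabw X (map f [0..<Suc n]) nu)
    (Sigma ?K (\<lambda>kap. tab p (map ?g [0..<n]) (\<lambda>_. 0) kap))
      (\<lambda>(kap, c). of_nat (psize nu - psize kap) * X (f 0) + tabw X (map ?g [0..<n]) kap c)"
    unfolding m by (rule weqI[where h = "\<lambda>c. (hd c, tl c)" and h' = "\<lambda>(kap, c). kap # c"]) auto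
  have 2: "weq (Sigma ?K (\<lambda>kap. tab p (map ?g [0..<n]) (\<lambda>_. 0) kap))
      (\<lambda>(kap, c). of_nat (psize nu - psize kap) * X (f 0) + tabw X (map ?g [0..<n]) kap c)
    (Sigma ?K (\<lambda>kap. ?S ?g n kap)) (\<lambda>(kap, A). of_nat (psize nu - psize kap) * X (f 0) + ?w ?g n A)"
    by (rule weq_Sigma, rule weq_weight[OF Suc.IH]) auto
  have 3: "weq (Sigma ?K (\<lambda>kap. ?S ?g n kap)) (\<lambda>(kap, A). of_nat (psize nu - psize kap) * X (f 0) + ?w ?g n A)
    (?S f (Suc n) nu) (?w f (Suc n))"
  proof (rule weqI[where h = "\<lambda>(kap, A). case_nat nu A" and h' = "\<lambda>A. (A 1, \<lambda>i. A (Suc i))"])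
    fix x assume "x \<in> Sigma ?K (\<lambda>kap. ?S ?g n kap)"
    then obtain A where x: "x = (A 0, A)" "strip (p (f 0)) (A 0) nu"
      "\<And>i. strip (p (f (Suc i))) (A (Suc i)) (A i)" "\<And>i. i \<ge> n \<Longrightarrow> A i = (\<lambda>_. 0)" by auto
    have "case_nat nu A \<in> ?S f (Suc n) nu" using x by (auto split: nat.splits)
    moreover have "?w f (Suc n) (case_nat nu A) = of_nat (psize nu - psize (A 0)) * X (f 0) + ?w ?g n A"
      by (simp add: sum.lessThan_Suc_shift del: sum.lessThan_Suc)
    ultimately show "(case x of (kap, A) \<Rightarrow> case_nat nu A) \<in> ?S f (Suc n) nu \<and>
      ((case x of (kap, A) \<Rightarrow> case_nat nu A) 1, \<lambda>i. (case x of (kap, A) \<Rightarrow> case_nat nu A) (Suc i)) = x \<and>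
      ?w f (Suc n) (case x of (kap, A) \<Rightarrow> case_nat nu A) =
        (case x of (kap, A) \<Rightarrow> of_nat (psize nu - psize kap) * X (f 0) + ?w ?g n A)"
      using x(1) by simp
  next
    fix A assume "A \<in> ?S f (Suc n) nu"
    then have A: "nu = A 0" "\<And>i. strip (p (f i)) (A (Suc i)) (A i)" "\<And>i. i \<ge> Suc n \<Longrightarrow> A i = (\<lambda>_. 0)"
      by auto
    have "case_nat (A 0) (\<lambda>i. A (Suc i)) = A" by (rule ext) (simp split: nat.split)
    then show "(A 1, \<lambda>i. A (Suc i)) \<in> Sigma ?K (\<lambda>kap. ?S ?g n kap) \<and>
      (case (A 1, \<lambda>i. A (Suc i)) of (kap, A) \<Rightarrow> case_nat nu A) = A"
      using A by simp
  qed
  show ?case by (rule weq_trans[OF weq_trans[OF 1 2] 3])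
qed

text \<open>A chain weighs each letter by its whole interval of colours, a plane partition weighs
  each colour by the cells whose entry reaches it; summation by parts passes between the two. The
  boundary term vanishes once \<open>a n = 0\<close>.\<close>

lemma abel_summation:
  fixes z :: "nat \<Rightarrow> 'w :: comm_semiring_1"
  assumes "\<And>i. a (Suc i) \<le> a i"
  shows "(\<Sum>i<n. of_nat (a i - a (Suc i)) * (\<Sum>t<Suc i. z t)) + of_nat (a n) * (\<Sum>t<n. z t) =
    (\<Sum>i<n. of_nat (a i) * z i)"
proof (induction n)
  case (Suc n)
  have "of_nat (a n - a (Suc n)) * (\<Sum>t<Suc n. z t) + of_nat (a (Suc n)) * (\<Sum>t<Suc n. z t) =
     (of_nat (a n) :: 'w) * (\<Sum>t<Suc n. z t)"
    unfolding distrib_right[symmetric] of_nat_add[symmetric] using assms by simp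
  then have "(\<Sum>i<Suc n. of_nat (a i - a (Suc i)) * (\<Sum>t<Suc i. z t)) + of_nat (a (Suc n)) * (\<Sum>t<Suc n. z t) =
    ((\<Sum>i<n. of_nat (a i - a (Suc i)) * (\<Sum>t<Suc i. z t)) + of_nat (a n) * (\<Sum>t<n. z t)) + of_nat (a n) * z n"
    by (simp only: sum.lessThan_Suc add.assoc) (simp add: algebra_simps)
  then show ?case using Suc by simp
qed simp

text \<open>\<open>slices Lam l\<close> is the shape of the cells with entry above \<open>l\<close>,
  its rows indexed by \<open>j\<close>. The letter \<open>Suc l\<close> occupies the cells lost on
  passing to \<open>slices Lam (Suc l)\<close>.\<close>

definition slices :: "(nat \<Rightarrow> nat \<Rightarrow> nat) \<Rightarrow> nat \<Rightarrow> nat \<Rightarrow> nat" where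
  "slices Lam l j = conj_part (Lam j) l"

definition unslice :: "(nat \<Rightarrow> nat \<Rightarrow> nat) \<Rightarrow> nat \<Rightarrow> nat \<Rightarrow> nat" where
  "unslice A j = conj_part (\<lambda>l. A l j)"

lemma unslice_slices: "(\<And>j. is_part (Lam j)) \<Longrightarrow> unslice (slices Lam) = Lam"
  by (simp add: unslice_def[abs_def] slices_def conj_conj)

lemma slices_unslice: "(\<And>j. is_part (\<lambda>l. A l j)) \<Longrightarrow> slices (unslice A) = A"
  by (simp add: unslice_def slices_def[abs_def] conj_conj)

text \<open>\<open>e\<close> marks odd letters, and entry 0 means an absent cell. The index
  \<open>i\<close> runs along a row and \<open>j\<close> down a column; weak decrease along rows is
  supplied by \<open>is_part (Lam j)\<close>.\<close>

definition supertab :: "(nat \<Rightarrow> bool) \<Rightarrow> (nat \<Rightarrow> nat \<Rightarrow> nat) \<Rightarrow> bool" where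
  "supertab e Lam \<longleftrightarrow> (\<forall>j i. Lam (Suc j) i \<le> Lam j i \<and>
     (Lam j i = Lam j (Suc i) \<longrightarrow> Lam j i = 0 \<or> \<not> e (Lam j i)) \<and>
     (Lam (Suc j) i = Lam j i \<longrightarrow> Lam j i = 0 \<or> e (Lam j i)))"

text \<open>A letter repeated at neighbouring places gives its strip two cells in one row, or two in
  one column. So the equality clauses of \<open>supertab\<close> say that odd letters fill vertical
  and even letters horizontal strips. \<open>fin\<close> ensures that slices have finitely many
  rows.\<close>

lemma slices_strip_iff:
  assumes part: "\<And>j. is_part (Lam j)" and fin: "\<And>j. j \<ge> r \<Longrightarrow> Lam j = (\<lambda>_. 0)"
  shows "(\<forall>l. strip (e (Suc l)) (slices Lam (Suc l)) (slices Lam l)) \<longleftrightarrow> supertab e Lam"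
proof
  note less = less_conj_part[OF part]
  assume "supertab e Lam"
  then have T: "\<And>j i. Lam (Suc j) i \<le> Lam j i"
    "\<And>j i. Lam j i = Lam j (Suc i) \<Longrightarrow> Lam j i = 0 \<or> \<not> e (Lam j i)"
    "\<And>j i. Lam (Suc j) i = Lam j i \<Longrightarrow> Lam j i = 0 \<or> e (Lam j i)"
    unfolding supertab_def by blast+
  have sp: "is_part (slices Lam l)" for l
    unfolding is_part_def
  proof (intro conjI allI exI impI)
    show "slices Lam l (Suc j) \<le> slices Lam l j" for j
      unfolding slices_def nat_le_less less using T(1) less_le_trans by blast
    show "slices Lam l j = 0" if "r \<le> j" for j using fin[OF that] by (simp add: slices_def conj_part_def)
  qed
  have le: "slices Lam (Suc l) j \<le> slices Lam l j" for l j
    unfolding slices_def nat_le_less less by auto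
  show "\<forall>l. strip (e (Suc l)) (slices Lam (Suc l)) (slices Lam l)"
  proof
    fix l
    show "strip (e (Suc l)) (slices Lam (Suc l)) (slices Lam l)"
    proof (cases "e (Suc l)")
      case True
      have "slices Lam l j \<le> Suc (slices Lam (Suc l) j)" for j
      proof (rule ccontr)
        define i where "i = slices Lam (Suc l) j"
        assume "\<not> slices Lam l j \<le> Suc (slices Lam (Suc l) j)"
        then have "Suc i < slices Lam l j" by (simp add: i_def)
        then have "l < Lam j (Suc i)" by (simp add: slices_def less)
        moreover have "\<not> i < slices Lam (Suc l) j" by (simp add: i_def)
        then have "\<not> Suc l < Lam j i" by (simp add: slices_def less)
        moreover have "Lam j (Suc i) \<le> Lam j i" using part[of j] by (simp add: is_part_def)
        ultimately have "Lam j i = Suc l" "Lam j (Suc i) = Suc l" by auto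
        then show False using T(2)[of j i] True by simp
      qed
      then show ?thesis using True sp le by (simp add: strip_def vstrip_def)
    next
      case False
      have "slices Lam l (Suc j) \<le> slices Lam (Suc l) j" for j
        unfolding slices_def nat_le_less less
      proof (intro allI impI)
        fix i assume "l < Lam (Suc j) i"
        then show "Suc l < Lam j i" using T(1)[of j i] T(3)[of j i] False
          by (metis Suc_lessI le_antisym less_le_trans nat.distinct(1) not_less_eq not_less)
      qed
      then show ?thesis using False sp le by (simp add: strip_def hstrip_def)
    qed
  qed
next
  note less = less_conj_part[OF part]
  assume S: "\<forall>l. strip (e (Suc l)) (slices Lam (Suc l)) (slices Lam l)"
  then have sp: "is_part (slices Lam l)" for l using strip_part by blast
  show "supertab e Lam" unfolding supertab_def
  proof (intro allI conjI impI)
    fix j i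
    show "Lam (Suc j) i \<le> Lam j i" unfolding nat_le_less less[symmetric]
      using sp unfolding is_part_def slices_def by (metis less_le_trans)
    show "Lam j i = 0 \<or> \<not> e (Lam j i)" if eq: "Lam j i = Lam j (Suc i)"
    proof (cases "Lam j i")
      case (Suc l)
      have "Suc i < slices Lam l j" "\<not> i < slices Lam (Suc l) j"
        using eq Suc by (simp_all add: slices_def less)
      then show ?thesis using S[rule_format, of l] Suc
        by (auto simp: strip_def vstrip_def dest!: spec[of _ j] split: if_splits)
    qed simp
    show "Lam j i = 0 \<or> e (Lam j i)" if eq: "Lam (Suc j) i = Lam j i"
    proof (cases "Lam j i")
      case (Suc l)
      have "i < slices Lam l (Suc j)" "\<not> i < slices Lam (Suc l) j"
        using eq Suc by (simp_all add: slices_def less)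
      then show ?thesis using S[rule_format, of l] Suc
        by (auto simp: strip_def hstrip_def dest!: spec[of _ j] split: if_splits)
    qed simp
  qed
qed

definition odd_right :: "(int \<Rightarrow> int) \<Rightarrow> int \<Rightarrow> nat \<Rightarrow> bool" where
  "odd_right s k a \<longleftrightarrow> s (k + int a) \<noteq> s k"

definition odd_left :: "(int \<Rightarrow> int) \<Rightarrow> int \<Rightarrow> nat \<Rightarrow> bool" where
  "odd_left s k b \<longleftrightarrow> s (k - int b) \<noteq> s k"

lemma len_conj: "len lam = conj_part lam 0"
  by (simp add: len_def conj_part_def)

text \<open>The clauses tying the two arrays together, that \<open>mu\<close> vanishes where
  \<open>lam\<close> does and that \<open>mu\<close> is at least as long as the next
  \<open>lam\<close>, are the two halves of interlacing of the supports. All other clauses concern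
  one array at a time.\<close>

lemma PP_iff:
  assumes pm: "\<And>i. s i = 1 \<or> s i = -1"
    and part: "\<And>j. is_part (fst (P j)) \<and> is_part (snd (P j))"
    and fin: "\<exists>r. \<forall>j\<ge>r. P j = (\<lambda>_. 0, \<lambda>_. 0)"
  shows "P \<in> PP_set s k \<longleftrightarrow>
    supertab (odd_right s k) (\<lambda>j. fst (P j)) \<and> supertab (odd_left s k) (\<lambda>j. snd (P j)) \<and>
    hstrip (slices (\<lambda>j. snd (P j)) 0) (slices (\<lambda>j. fst (P j)) 0)"
proof -
  define A where "A j = fst (P j)" for j
  define B where "B j = snd (P j)" for j
  have P: "P j = (A j, B j)" for j by (simp add: A_def B_def)
  have pA: "is_part (A j)" and pB: "is_part (B j)" for j using part by (auto simp: A_def B_def)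
  have opp: "s i = - s k \<longleftrightarrow> s i \<noteq> s k" for i using pm[of i] pm[of k] by auto
  \<comment> \<open>Zero entries satisfy the equality clauses because the sign is
    \<open>s k\<close>: both \<open>s (k + 0)\<close> and \<open>s (k - 0)\<close> equal it.\<close>
  have P_set: "P j \<in> P_set s k (s k) \<longleftrightarrow> (\<forall>i. A j i = 0 \<longrightarrow> B j i = 0) \<and>
      (\<forall>i. A j i = A j (Suc i) \<longrightarrow> A j i = 0 \<or> \<not> odd_right s k (A j i)) \<and>
      (\<forall>i. B j i = B j (Suc i) \<longrightarrow> B j i = 0 \<or> \<not> odd_left s k (B j i))" for j
    unfolding P P_set_def odd_right_def odd_left_def using pA pB by auto
  \<comment> \<open>Past its length a sequence vanishes, so the quantifiers over
    \<open>i < len\<close> extend to all \<open>i\<close>; lengths within one array then compare by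
    \<open>mono\<close>.\<close>
  have geq1: "geq_k s k (P j) (P (Suc j)) \<longleftrightarrow> len (A (Suc j)) \<le> len (B j) \<and>
      (\<forall>i. A (Suc j) i \<le> A j i \<and> (A (Suc j) i = A j i \<longrightarrow> A j i = 0 \<or> odd_right s k (A j i))) \<and>
      (\<forall>i. B (Suc j) i \<le> B j i \<and> (B (Suc j) i = B j i \<longrightarrow> B j i = 0 \<or> odd_left s k (B j i)))" for j
  proof -
    have mono: "len a \<le> len b" if "\<And>i. a i \<le> b i" "is_part a" "is_part b" for a b
      unfolding len_conj nat_le_less less_conj_part[OF that(2)] less_conj_part[OF that(3)]
      using that(1) less_le_trans by blast
    have lA: "i < len (A (Suc j)) \<longleftrightarrow> 0 < A (Suc j) i" and lB: "i < len (B (Suc j)) \<longleftrightarrow> 0 < B (Suc j) i" for i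
      by (simp_all add: len_conj less_conj_part pA pB)
    show ?thesis
      unfolding P geq_k_def prod.case lA lB opp odd_right_def odd_left_def
      using mono[of "A (Suc j)" "A j"] mono[of "B (Suc j)" "B j"] pA pB
      by (auto simp: add.commute) (metis bot_nat_0.not_eq_extremum le0)+
  qed
  have hs: "hstrip (slices B 0) (slices A 0) \<longleftrightarrow>
    (\<forall>j i. A j i = 0 \<longrightarrow> B j i = 0) \<and> (\<forall>j. len (A (Suc j)) \<le> len (B j))"
    if "supertab (odd_right s k) A" "supertab (odd_left s k) B"
  proof -
    obtain r where "\<forall>j\<ge>r. P j = (\<lambda>_. 0, \<lambda>_. 0)" using fin by blast
    then have "\<And>j. j \<ge> r \<Longrightarrow> A j = (\<lambda>_. 0)" "\<And>j. j \<ge> r \<Longrightarrow> B j = (\<lambda>_. 0)"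
      by (auto simp: A_def B_def)
    then have "is_part (slices A 0)" "is_part (slices B 0)"
      using slices_strip_iff[of A r, OF pA] slices_strip_iff[of B r, OF pB] that strip_part by blast+
    moreover have "(\<forall>j. slices B 0 j \<le> slices A 0 j) \<longleftrightarrow> (\<forall>j i. A j i = 0 \<longrightarrow> B j i = 0)"
      unfolding slices_def nat_le_less less_conj_part[OF pA] less_conj_part[OF pB]
      by (metis bot_nat_0.not_eq_extremum)
    ultimately show ?thesis by (auto simp: hstrip_def slices_def len_conj)
  qed
  have "P \<in> PP_set s k \<longleftrightarrow> (\<forall>j. P j \<in> P_set s k (s k)) \<and> (\<forall>j. geq_k s k (P j) (P (Suc j)))"
    using fin by (auto simp: PP_set_def)
  also have "\<dots> \<longleftrightarrow> supertab (odd_right s k) A \<and> supertab (odd_left s k) B \<and> hstrip (slices B 0) (slices A 0)"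
    unfolding P_set geq1 using hs unfolding supertab_def by blast
  finally show ?thesis unfolding A_def B_def .
qed

text \<open>The common shape \<open>slices A 0\<close> is put in front of the slices of the second
  array, so that index 0 becomes the step of the even letter 0. This shift explains the bound
  \<open>Suc L\<close> for the second chain and why \<open>w\<close> reads \<open>B\<close> from
  index 1.\<close>

lemma PP_weq_chains:
  assumes pm: "\<And>i. s i = 1 \<or> s i = -1"
  shows "weq {P \<in> PP_set s k. \<forall>j i. fst (P j) i \<le> L \<and> snd (P j) i \<le> L}
     (\<lambda>P. w (slices (\<lambda>j. fst (P j))) (slices (\<lambda>j. snd (P j))))
    {(A, B). B 0 = A 0 \<and> (\<forall>l. strip (odd_right s k (Suc l)) (A (Suc l)) (A l)) \<and> (\<forall>l\<ge>L. A l = (\<lambda>_. 0)) \<and>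
      (\<forall>l. strip (odd_left s k l) (B (Suc l)) (B l)) \<and> (\<forall>l\<ge>Suc L. B l = (\<lambda>_. 0))}
     (\<lambda>(A, B). w A (\<lambda>l. B (Suc l)))"
    (is "weq ?S ?f ?C ?g")
proof (rule weqI[where
    h = "\<lambda>P. (slices (\<lambda>j. fst (P j)), case_nat (slices (\<lambda>j. fst (P j)) 0) (slices (\<lambda>j. snd (P j))))"
    and h' = "\<lambda>(A, B) j. (unslice A j, unslice (\<lambda>l. B (Suc l)) j)"])
  let ?R = "odd_right s k" and ?Q = "odd_left s k"
  have q0: "?Q 0 = False" by (simp add: odd_left_def)
  {
    fix P assume P: "P \<in> ?S"
    define A where "A j = fst (P j)" for j
    define B where "B j = snd (P j)" for j
    have "P \<in> PP_set s k" and le: "A j i \<le> L" "B j i \<le> L" for i j using P by (auto simp: A_def B_def)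
    then have "P j \<in> P_set s k (s k)" and fin: "\<exists>r. \<forall>j\<ge>r. P j = (\<lambda>_. 0, \<lambda>_. 0)" for j by (auto simp: PP_set_def)
    then have p: "is_part (A j)" "is_part (B j)" for j
      unfolding A_def B_def P_set_def by (auto simp: case_prod_unfold)
    then have *: "supertab ?R A" "supertab ?Q B" "hstrip (slices B 0) (slices A 0)"
      using PP_iff[where s = s and k = k and P = P, OF pm _ fin] p P by (auto simp: A_def[abs_def] B_def[abs_def])
    obtain r where "\<forall>j\<ge>r. P j = (\<lambda>_. 0, \<lambda>_. 0)" using fin by blast
    then have r: "\<And>j. j \<ge> r \<Longrightarrow> A j = (\<lambda>_. 0)" "\<And>j. j \<ge> r \<Longrightarrow> B j = (\<lambda>_. 0)"
      by (auto simp: A_def B_def)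
    have z: "slices A l = (\<lambda>_. 0)" "slices B l = (\<lambda>_. 0)" if "l \<ge> L" for l
    proof -
      have "\<not> l < A j i" "\<not> l < B j i" for i j using le[of j i] that by linarith+
      then show "slices A l = (\<lambda>_. 0)" "slices B l = (\<lambda>_. 0)"
        by (simp_all add: slices_def conj_part_def fun_eq_iff)
    qed
    have "\<forall>l. strip (?R (Suc l)) (slices A (Suc l)) (slices A l)"
      using slices_strip_iff[of A r, OF p(1) r(1)] * by blast
    moreover have "\<forall>l. strip (?Q l) (case_nat (slices A 0) (slices B) (Suc l)) (case_nat (slices A 0) (slices B) l)"
    proof
      fix l show "strip (?Q l) (case_nat (slices A 0) (slices B) (Suc l)) (case_nat (slices A 0) (slices B) l)"
        using slices_strip_iff[of B r ?Q, OF p(2) r(2)] * by (cases l) (auto simp: q0, simp add: strip_def)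
    qed
    moreover have "unslice (slices A) = A" "unslice (slices B) = B" using unslice_slices p by blast+
    moreover have AB: "(\<lambda>j. fst (P j)) = A" "(\<lambda>j. snd (P j)) = B" "(\<lambda>j. (A j, B j)) = P"
      by (simp_all add: A_def[abs_def] B_def[abs_def])
    ultimately show "(slices (\<lambda>j. fst (P j)), case_nat (slices (\<lambda>j. fst (P j)) 0) (slices (\<lambda>j. snd (P j)))) \<in> ?C \<and>
      (case (slices (\<lambda>j. fst (P j)), case_nat (slices (\<lambda>j. fst (P j)) 0) (slices (\<lambda>j. snd (P j)))) of
        (A, B) \<Rightarrow> \<lambda>j. (unslice A j, unslice (\<lambda>l. B (Suc l)) j)) = P \<and>
      ?g (slices (\<lambda>j. fst (P j)), case_nat (slices (\<lambda>j. fst (P j)) 0) (slices (\<lambda>j. snd (P j)))) = ?f P"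
      unfolding AB using z by (auto simp: Suc_le_eq AB split: nat.split)
  next
    fix y assume "y \<in> ?C"
    then obtain A B' where y: "y = (A, B')" and C: "B' 0 = A 0" "\<And>l. strip (?R (Suc l)) (A (Suc l)) (A l)"
      "\<And>l. l \<ge> L \<Longrightarrow> A l = (\<lambda>_. 0)" "\<And>l. strip (?Q l) (B' (Suc l)) (B' l)" "\<And>l. l \<ge> Suc L \<Longrightarrow> B' l = (\<lambda>_. 0)"
      by blast
    define B where "B l = B' (Suc l)" for l
    have B: "strip False (B 0) (A 0)" "\<And>l. strip (?Q (Suc l)) (B (Suc l)) (B l)" "\<And>l. l \<ge> L \<Longrightarrow> B l = (\<lambda>_. 0)"
      using C(1) C(4)[of 0] C(4,5) by (auto simp: B_def q0)
    have pa: "is_part (\<lambda>l. A l j)" "is_part (\<lambda>l. B l j)" for j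
      using C(2,3) B(2,3) strip_part unfolding is_part_def by metis+
    have s: "slices (unslice A) = A" "slices (unslice B) = B" using slices_unslice pa by blast+
    define P where "P j = (unslice A j, unslice B j)" for j
    have part: "is_part (unslice A j)" "is_part (unslice B j)" for j
      unfolding unslice_def using pa is_part_conj by blast+
    have le: "A l j \<le> A 0 j" "B l j \<le> B 0 j" for l j using is_part_mono[OF pa(1), of 0] is_part_mono[OF pa(2), of 0] by auto
    obtain r where "\<And>j. j \<ge> r \<Longrightarrow> A 0 j = 0" "\<And>j. j \<ge> r \<Longrightarrow> B 0 j = 0"
      using is_part_bound2 B(1) strip_part by metis
    then have "A l j = 0" "B l j = 0" if "j \<ge> r" for l j using le[of l j] that by auto
    then have r: "unslice A j = (\<lambda>_. 0)" "unslice B j = (\<lambda>_. 0)" if "j \<ge> r" for j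
      using that by (auto simp: unslice_def conj_part_def fun_eq_iff)
    have "supertab ?R (unslice A)" "supertab ?Q (unslice B)"
      using slices_strip_iff[of "unslice A" r ?R, OF part(1) r(1)]
        slices_strip_iff[of "unslice B" r ?Q, OF part(2) r(2)] C(2) B(2) s by auto
    moreover have "hstrip (slices (unslice B) 0) (slices (unslice A) 0)" using B(1) s by (simp add: strip_def)
    moreover have "\<exists>r. \<forall>j\<ge>r. P j = (\<lambda>_. 0, \<lambda>_. 0)" using r by (auto simp: P_def)
    ultimately have "P \<in> PP_set s k" using PP_iff[where s = s and k = k and P = P, OF pm] part by (auto simp: P_def)
    moreover have "unslice A j i \<le> L" "unslice B j i \<le> L" for i j
    proof -
      have "\<not> L < unslice A j i" "\<not> L < unslice B j i"
        using less_conj_part[OF part(1)[of j], of i L] less_conj_part[OF part(2)[of j], of i L] C(3) B(3)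
        by (simp_all add: slices_def[symmetric] s)
      then show "unslice A j i \<le> L" "unslice B j i \<le> L" by auto
    qed
    moreover have "case_nat (A 0) B = B'" using C(1) by (auto simp: fun_eq_iff B_def split: nat.splits)
    ultimately show "(case y of (A, B) \<Rightarrow> \<lambda>j. (unslice A j, unslice (\<lambda>l. B (Suc l)) j)) \<in> ?S \<and>
      (slices (\<lambda>j. fst ((case y of (A, B) \<Rightarrow> \<lambda>j. (unslice A j, unslice (\<lambda>l. B (Suc l)) j)) j)),
       case_nat (slices (\<lambda>j. fst ((case y of (A, B) \<Rightarrow> \<lambda>j. (unslice A j, unslice (\<lambda>l. B (Suc l)) j)) j)) 0)
         (slices (\<lambda>j. snd ((case y of (A, B) \<Rightarrow> \<lambda>j. (unslice A j, unslice (\<lambda>l. B (Suc l)) j)) j)))) = y"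
      unfolding y prod.case B_def[symmetric, abs_def] by (simp add: P_def[abs_def] s)
  }
qed

section \<open>Coefficients of the infinite product\<close>

definition deg :: "mono \<Rightarrow> nat" where
  "deg a = (\<Sum>i\<in>Poly_Mapping.keys a. Poly_Mapping.lookup a i)"

lemma deg_eq: "finite S \<Longrightarrow> Poly_Mapping.keys a \<subseteq> S \<Longrightarrow> deg a = (\<Sum>i\<in>S. Poly_Mapping.lookup a i)"
  unfolding deg_def by (rule sum.mono_neutral_left) (auto simp: in_keys_iff)

lemma deg_0 [simp]: "deg 0 = 0"
  by (simp add: deg_def)

lemma deg_add [simp]: "deg (a + b) = deg a + deg b"
proof -
  let ?S = "Poly_Mapping.keys a \<union> Poly_Mapping.keys b"
  have "deg (a + b) = (\<Sum>i\<in>?S. Poly_Mapping.lookup (a + b) i)"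
    by (rule deg_eq) (use Poly_Mapping.keys_add[of a b] in auto)
  also have "\<dots> = deg a + deg b" 
    by (simp add: lookup_add sum.distrib deg_eq[of ?S a] deg_eq[of ?S b])
  finally show ?thesis .
qed

lemma deg_sum [simp]: "deg (sum f S) = (\<Sum>x\<in>S. deg (f x))"
  by (induction S rule: infinite_finite_induct) auto

lemma deg_of_nat_mult [simp]: "deg (of_nat n * a) = n * deg a"
  by (induction n) (auto simp: algebra_simps)

lemma deg_zvar [simp]: "deg (zvar N t) = 1"
  by (simp add: deg_def zvar_def)

lemma deg_zij: "deg (zij N i j) = card {i..j}"
  by (simp add: zij_def)

lemma of_nat_mult_inject:
  fixes W :: mono assumes "deg W > 0" shows "of_nat r * W = of_nat r' * W \<longleftrightarrow> r = r'"
  using assms by (metis deg_of_nat_mult mult_cancel2 not_less_zero)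

lemma finite_le_mono: "finite {b :: mono. \<exists>c. b + c = a}"
proof -
  let ?T = "{f. \<forall>i. (i \<in> Poly_Mapping.keys a \<longrightarrow> f i \<in> {..deg a}) \<and> (i \<notin> Poly_Mapping.keys a \<longrightarrow> f i = 0)}"
  have "finite ?T" by (rule finite_set_of_finite_funs) auto
  moreover have "Poly_Mapping.lookup ` {b. \<exists>c. b + c = a} \<subseteq> ?T"
  proof (clarsimp, intro conjI impI)
    fix b c :: mono and i
    have "Poly_Mapping.lookup (b + c) i = Poly_Mapping.lookup b i + Poly_Mapping.lookup c i" by (simp add: lookup_add)
    then show "Poly_Mapping.lookup b i = 0" if "i \<notin> Poly_Mapping.keys (b + c)"
      using that by (simp add: in_keys_iff)
    show "Poly_Mapping.lookup b i \<le> deg b + deg c" if "i \<in> Poly_Mapping.keys (b + c)"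
    proof (cases "i \<in> Poly_Mapping.keys b")
      case True then show ?thesis unfolding deg_def[of b] by (simp add: member_le_sum trans_le_add1)
    qed (simp add: in_keys_iff)
  qed
  ultimately have "finite (Poly_Mapping.lookup ` {b. \<exists>c. b + c = a})" by (rule finite_subset[rotated])
  then show ?thesis by (rule finite_imageD) (auto intro!: inj_onI poly_mapping_eqI)
qed

lemma finite_sum_pairs: "finite {(b, c). b + c = (a :: mono)}"
proof -
  have "{(b, c). b + c = a} \<subseteq> {b. \<exists>c. b + c = a} \<times> {b. \<exists>c. b + c = a}"
    by (clarsimp, metis add.commute)
  then show ?thesis using finite_le_mono by (meson finite_SigmaI finite_subset)
qed

section \<open>Multiplication by \<open>1 - x W\<close> and its inversion\<close>

lemma times_one_right: "mfps_times f mfps_one = f"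
proof
  fix a
  have "mfps_times f mfps_one a = (\<Sum>bc\<in>{(b, c). b + c = a}. if bc = (a, 0) then f a else 0)"
    unfolding mfps_times_def by (rule sum.cong) (auto simp: mfps_one_def split: if_splits)
  also have "\<dots> = f a" using finite_sum_pairs[of a] by simp
  finally show "mfps_times f mfps_one a = f a" .
qed

text \<open>The sum has at most one term; it expresses the coefficient at \<open>a - W\<close>
  without subtracting monomials, and is empty if \<open>W\<close> does not divide
  \<open>a\<close>.\<close>

lemma times_one_minus_monom:
  assumes "W \<noteq> 0"
  shows "mfps_times (mfps_minus mfps_one (mfps_monom x W)) g a =
    g a - x * (\<Sum>c | W + c = a. g c)"
proof -
  let ?S = "{(b, c). b + c = a}"
  have "mfps_times (mfps_minus mfps_one (mfps_monom x W)) g a =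
    (\<Sum>bc\<in>?S. (if fst bc = 0 then g (snd bc) else 0) - x * (if fst bc = W then g (snd bc) else 0))"
    unfolding mfps_times_def by (rule sum.cong) (auto simp: mfps_minus_def mfps_one_def mfps_monom_def assms)
  also have "\<dots> = (\<Sum>bc\<in>?S. if fst bc = 0 then g (snd bc) else 0) - x * (\<Sum>bc\<in>?S. if fst bc = W then g (snd bc) else 0)"
    by (simp add: sum_subtractf sum_distrib_left)
  also have "(\<Sum>bc\<in>?S. if fst bc = 0 then g (snd bc) else 0) = (\<Sum>bc\<in>?S. if bc = (0, a) then g a else 0)"
    by (rule sum.cong) auto
  also have "\<dots> = g a" using finite_sum_pairs[of a] by simp
  also have "(\<Sum>bc\<in>?S. if fst bc = W then g (snd bc) else 0) = (\<Sum>bc\<in>{bc \<in> ?S. fst bc = W}. g (snd bc))"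
    by (rule sum.inter_filter[symmetric, OF finite_sum_pairs])
  also have "\<dots> = (\<Sum>c | W + c = a. g c)"
    by (rule sum.reindex_bij_witness[where i = "\<lambda>c. (W, c)" and j = snd]) auto
  finally show ?thesis .
qed

lemma sum_left_cancel: "(\<Sum>c | W + c = W + c0. g c) = g (c0 :: mono)"
proof -
  have "{c. W + c = W + c0} = {c0}" by auto
  then show ?thesis by simp
qed

text \<open>The geometric series. The inverse is a definite description, so uniqueness matters too:
  as \<open>W\<close> has positive degree, each coefficient of a solution is determined by
  coefficients of smaller degree.\<close>

lemma mfps_inverse_one_minus_monom:
  assumes "deg W > 0"
  shows "mfps_inverse (mfps_minus mfps_one (mfps_monom 1 W)) = (\<lambda>a. if \<exists>r. a = of_nat r * W then 1 else 0)"
    (is "mfps_inverse ?f = ?g")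
  unfolding mfps_inverse_def
proof (rule the_equality)
  have W: "W \<noteq> 0" using assms by auto
  note T = times_one_minus_monom[OF W, of 1, simplified]
  show "mfps_times ?f ?g = mfps_one"
  proof
    fix a
    show "mfps_times ?f ?g a = mfps_one a"
    proof (cases "\<exists>c. W + c = a")
      case True
      then obtain c where c: "a = W + c" by auto
      have "a \<noteq> 0" using c assms by (metis deg_0 deg_add add_is_0 less_irrefl)
      have "(\<exists>r. a = of_nat r * W) \<longleftrightarrow> (\<exists>r. c = of_nat r * W)"
      proof
        assume "\<exists>r. a = of_nat r * W"
        then obtain r where r: "a = of_nat r * W" by auto
        with \<open>a \<noteq> 0\<close> obtain r' where "r = Suc r'" by (cases r) auto
        then have "c = of_nat r' * W" using r c by (simp add: algebra_simps)
        then show "\<exists>r. c = of_nat r * W" by blast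
      next
        assume "\<exists>r. c = of_nat r * W"
        then obtain r where "c = of_nat r * W" by auto
        then have "a = of_nat (Suc r) * W" using c by (simp add: algebra_simps)
        then show "\<exists>r. a = of_nat r * W" by blast
      qed
      then show ?thesis using \<open>a \<noteq> 0\<close> unfolding T c sum_left_cancel by (simp add: mfps_one_def)
    next
      case False
      then have e: "{c. W + c = a} = {}" by auto
      have "(\<exists>r. a = of_nat r * W) \<longleftrightarrow> a = 0"
      proof
        assume "\<exists>r. a = of_nat r * W"
        then obtain r where r: "a = of_nat r * W" by auto
        show "a = 0"
        proof (cases r)
          case (Suc r')
          then have "W + of_nat r' * W = a" using r by (simp add: algebra_simps)
          then show ?thesis using False by blast
        qed (use r in simp)
      qed (auto intro: exI[of _ 0])
      then show ?thesis unfolding T e by (simp add: mfps_one_def)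
    qed
  qed
  fix g assume g: "mfps_times ?f g = mfps_one"
  have "g a = ?g a" for a
  proof (induction "deg a" arbitrary: a rule: less_induct)
    case less
    have "mfps_times ?f g a = mfps_times ?f ?g a" using g \<open>mfps_times ?f ?g = mfps_one\<close> by simp
    then have "g a - (\<Sum>c | W + c = a. g c) = ?g a - (\<Sum>c | W + c = a. ?g c)" unfolding T .
    moreover have "(\<Sum>c | W + c = a. g c) = (\<Sum>c | W + c = a. ?g c)"
      by (rule sum.cong) (use less assms in auto)
    ultimately show ?case by simp
  qed
  then show "g = ?g" by blast
qed

text \<open>Each \<open>(-1) ^ nat (bar s t)\<close> is \<open>s t * s (t + 1)\<close>, and the
  product telescopes.\<close>

lemma sgn_s_eq:
  assumes pm: "\<And>i. s i = 1 \<or> s i = -1" and "i \<le> j"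
  shows "sgn_s s i j = s i * s (j + 1)"
  using \<open>i \<le> j\<close>
proof (induction j rule: int_ge_induct)
  case base
  show ?case using pm[of i] pm[of "i + 1"] by (auto simp: sgn_s_def bar_def)
next
  case (step j)
  have e: "{i..j + 1} = insert (j + 1) {i..j}" using step.hyps by auto
  have b: "0 \<le> bar s t" for t using pm[of t] pm[of "t + 1"] by (auto simp: bar_def)
  have "sgn_s s i (j + 1) = (-1) ^ nat (bar s (j + 1)) * sgn_s s i j"
    unfolding sgn_s_def e using b by (simp add: nat_add_distrib sum_nonneg power_add)
  also have "(-1) ^ nat (bar s (j + 1)) = s (j + 1) * s (j + 2)"
    using pm[of "j + 1"] pm[of "j + 2"] by (auto simp: bar_def add.assoc)
  also have "s (j + 1) * s (j + 2) * sgn_s s i j = s i * s (j + 1 + 1)"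
    unfolding step.IH using pm[of "j + 1"] by (auto simp: add.assoc)
  finally show ?case .
qed

text \<open>Sign 1 gives the inverse of \<open>1 - z\<close>, sign -1 gives \<open>1 + z\<close> to
  the first power; either way all coefficients are 0 or 1.\<close>

lemma macfactor_coeff:
  assumes pm: "\<And>i. s i = 1 \<or> s i = -1" and "i \<le> j"
  shows "macfactor N s (i, j) a = (if \<exists>r\<in>bits (s i \<noteq> s (j + 1)). a = of_nat r * zij N i j then 1 else 0)"
proof (cases "s i = s (j + 1)")
  case True
  have d: "deg (zij N i j) > 0" using \<open>i \<le> j\<close> by (simp add: deg_zij)
  have "sgn_s s i j = 1" using sgn_s_eq[OF pm \<open>i \<le> j\<close>] True pm[of "j + 1"] by auto
  then show ?thesis using True
    by (simp add: macfactor_def mfps_zpow_def times_one_right mfps_inverse_one_minus_monom[OF d] bits_def)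
next
  case False
  have d: "deg (zij N i j) > 0" using \<open>i \<le> j\<close> by (simp add: deg_zij)
  then have "zij N i j \<noteq> 0" by auto
  have "sgn_s s i j = -1" using sgn_s_eq[OF pm \<open>i \<le> j\<close>] False pm[of "j + 1"] pm[of i] by auto
  then show ?thesis using False \<open>zij N i j \<noteq> 0\<close>
    by (auto simp: macfactor_def mfps_zpow_def times_one_right bits_def mfps_minus_def mfps_one_def mfps_monom_def)
qed

lemma prod_indicator: "finite F \<Longrightarrow> (\<Prod>x\<in>F. if P x then 1 else 0 :: int) = (if \<forall>x\<in>F. P x then 1 else 0)"
  by (induction F rule: finite_induct) auto

text \<open>A product of 0/1 series counts the admissible choices of one monomial per factor.
  Positive degree of \<open>W x\<close> lets the multiplicity be read off from the chosen
  monomial.\<close>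

lemma mfps_prod_coeff:
  assumes "finite F"
    and f: "\<And>x a. x \<in> F \<Longrightarrow> f x a = (if \<exists>r\<in>S x. a = of_nat r * W x then 1 else 0)"
    and W: "\<And>x. x \<in> F \<Longrightarrow> deg (W x) > 0"
  shows "mfps_prod F f a = int (card {r \<in> PiE F S. (\<Sum>x\<in>F. of_nat (r x) * W x) = a})"
proof -
  let ?C = "{c. c \<in> F \<rightarrow>\<^sub>E UNIV \<and> (\<Sum>x\<in>F. c x) = a}"
  have finC: "finite ?C"
  proof (rule finite_subset)
    show "?C \<subseteq> PiE F (\<lambda>_. {b. \<exists>c. b + c = a})"
    proof clarify
      fix c assume c: "c \<in> F \<rightarrow>\<^sub>E (UNIV :: mono set)"
      have "\<exists>d. c x + d = sum c F" if "x \<in> F" for x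
        using sum.remove[OF assms(1) that, of c] by metis
      then show "c \<in> PiE F (\<lambda>_. {b. \<exists>ca. b + ca = sum c F})" using c by (auto simp: PiE_iff)
    qed
    show "finite (PiE F (\<lambda>_. {b. \<exists>c. b + c = a}))" by (rule finite_PiE[OF assms(1)]) (rule finite_le_mono)
  qed
  have "mfps_prod F f a = (\<Sum>c\<in>?C. if \<forall>x\<in>F. \<exists>r\<in>S x. c x = of_nat r * W x then 1 else 0)"
    unfolding mfps_prod_def by (rule sum.cong) (auto simp: f prod_indicator[OF assms(1)] cong: prod.cong)
  also have "\<dots> = int (card {c \<in> ?C. \<forall>x\<in>F. \<exists>r\<in>S x. c x = of_nat r * W x})"
    using finC by (simp add: sum.If_cases Int_def)
  also have "card {c \<in> ?C. \<forall>x\<in>F. \<exists>r\<in>S x. c x = of_nat r * W x} =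
     card {r \<in> PiE F S. (\<Sum>x\<in>F. of_nat (r x) * W x) = a}"
  proof (rule bij_betw_same_card[symmetric], rule bij_betw_imageI)
    let ?h = "\<lambda>r. \<lambda>x\<in>F. of_nat (r x) * W x"
    show "inj_on ?h {r \<in> PiE F S. (\<Sum>x\<in>F. of_nat (r x) * W x) = a}"
    proof (rule inj_onI)
      fix r r' assume r: "r \<in> {r \<in> PiE F S. (\<Sum>x\<in>F. of_nat (r x) * W x) = a}"
        "r' \<in> {r \<in> PiE F S. (\<Sum>x\<in>F. of_nat (r x) * W x) = a}" and eq: "?h r = ?h r'"
      have "r x = r' x" if "x \<in> F" for x
        using fun_cong[OF eq, of x] that of_nat_mult_inject[OF W[OF that]] by simp
      then show "r = r'" using r by (intro extensionalityI[of _ F]) (auto simp: PiE_iff)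
    qed
    show "?h ` {r \<in> PiE F S. (\<Sum>x\<in>F. of_nat (r x) * W x) = a} = {c \<in> ?C. \<forall>x\<in>F. \<exists>r\<in>S x. c x = of_nat r * W x}"
    proof (intro equalityI subsetI)
      fix c assume c: "c \<in> {c \<in> ?C. \<forall>x\<in>F. \<exists>r\<in>S x. c x = of_nat r * W x}"
      then obtain r where r: "\<And>x. x \<in> F \<Longrightarrow> r x \<in> S x \<and> c x = of_nat (r x) * W x" by simp metis
      have "c = ?h (restrict r F)" using c r by (intro extensionalityI[of _ F]) (auto simp: PiE_iff)
      moreover have "restrict r F \<in> {r \<in> PiE F S. (\<Sum>x\<in>F. of_nat (r x) * W x) = a}"
        using c r by auto
      ultimately show "c \<in> ?h ` {r \<in> PiE F S. (\<Sum>x\<in>F. of_nat (r x) * W x) = a}" by blast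
    qed (auto simp: PiE_iff)
  qed
  finally show ?thesis .
qed

text \<open>Two candidate limits are compared at the union of their stages.\<close>

lemma net_limI:
  assumes "finite F0" "F0 \<subseteq> I" "\<And>F. finite F \<Longrightarrow> F0 \<subseteq> F \<Longrightarrow> F \<subseteq> I \<Longrightarrow> G F a = c"
  shows "mfps_net_lim I G a = c"
  unfolding mfps_net_lim_def
proof (rule the_equality)
  show "\<exists>F0. finite F0 \<and> F0 \<subseteq> I \<and> (\<forall>F. finite F \<and> F0 \<subseteq> F \<and> F \<subseteq> I \<longrightarrow> G F a = c)"
    using assms by blast
next
  fix c' assume "\<exists>F0. finite F0 \<and> F0 \<subseteq> I \<and> (\<forall>F. finite F \<and> F0 \<subseteq> F \<and> F \<subseteq> I \<longrightarrow> G F a = c')"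
  then obtain F1 where "finite F1" "F1 \<subseteq> I" "\<forall>F. finite F \<and> F1 \<subseteq> F \<and> F \<subseteq> I \<longrightarrow> G F a = c'"
    by (elim exE conjE)
  then have "G (F0 \<union> F1) a = c'" using assms(1,2) by simp
  then show "c' = c" using assms(3)[of "F0 \<union> F1"] assms(1,2) \<open>finite F1\<close> \<open>F1 \<subseteq> I\<close> by simp
qed

section \<open>The character formula\<close>

lemma sum_rows_by_column:
  fixes z :: "nat \<Rightarrow> 'w :: comm_semiring_1"
  assumes "is_part lam" "\<And>i. lam i \<le> L"
  shows "(\<Sum>i | lam i \<noteq> 0. \<Sum>t<lam i. z t) = (\<Sum>l<L. of_nat (conj_part lam l) * z l)"
proof -
  let ?J = "{i. lam i \<noteq> 0}"
  have J: "finite ?J" using is_part_finite[OF assms(1), of 0] by simp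
  have "(\<Sum>i\<in>?J. \<Sum>t<lam i. z t) = (\<Sum>i\<in>?J. \<Sum>t<L. if t < lam i then z t else 0)"
  proof (rule sum.cong[OF refl])
    fix i
    have "{..<lam i} = {t \<in> {..<L}. t < lam i}" using assms(2)[of i] by auto
    then show "(\<Sum>t<lam i. z t) = (\<Sum>t<L. if t < lam i then z t else 0)"
      by (simp only: sum.inter_filter finite_lessThan)
  qed
  also have "\<dots> = (\<Sum>t<L. \<Sum>i\<in>?J. if t < lam i then z t else 0)" by (rule sum.swap)
  also have "\<dots> = (\<Sum>t<L. of_nat (conj_part lam t) * z t)"
  proof (rule sum.cong[OF refl])
    fix t
    have "{i \<in> ?J. t < lam i} = {i. t < lam i}" by auto
    then show "(\<Sum>i\<in>?J. if t < lam i then z t else 0) = of_nat (conj_part lam t) * z t"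
      using sum.inter_filter[OF J, of "\<lambda>_. z t" "\<lambda>i. t < lam i"] by (simp add: conj_part_def)
  qed
  finally show ?thesis .
qed

lemma sum_slices:
  fixes z :: "nat \<Rightarrow> 'w :: comm_semiring_1"
  assumes "finite F" "\<And>j. j \<notin> F \<Longrightarrow> Lam j = (\<lambda>_. 0)" "\<And>j. is_part (Lam j)" "\<And>j i. Lam j i \<le> L"
  shows "(\<Sum>j\<in>F. \<Sum>i | Lam j i \<noteq> 0. \<Sum>t<Lam j i. z t) = (\<Sum>l<L. of_nat (psize (slices Lam l)) * z l)"
proof -
  have "psize (slices Lam l) = (\<Sum>j\<in>F. conj_part (Lam j) l)" for l
    unfolding psize_def slices_def
    by (rule sum.mono_neutral_left) (use assms(1,2) in \<open>auto simp: conj_part_def intro: ccontr\<close>)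
  then have "(\<Sum>l<L. of_nat (psize (slices Lam l)) * z l) = (\<Sum>l<L. \<Sum>j\<in>F. of_nat (conj_part (Lam j) l) * z l)"
    by (simp add: sum_distrib_right)
  also have "\<dots> = (\<Sum>j\<in>F. \<Sum>l<L. of_nat (conj_part (Lam j) l) * z l)" by (rule sum.swap)
  finally show ?thesis by (simp only: sum_rows_by_column[OF assms(3,4)])
qed

lemma wt_eq: "wt N k (lam, mu) = (\<Sum>j | lam j \<noteq> 0. \<Sum>t<lam j. zvar N (k + int t)) +
  (\<Sum>j | mu j \<noteq> 0. \<Sum>t<mu j. zvar N (k - 1 - int t))"
proof -
  have "(\<Sum>t\<in>{1..n}. zvar N (k - int t)) = (\<Sum>t<n. zvar N (k - 1 - int t))" for n
    by (rule sum.reindex_bij_witness[where i = Suc and j = "\<lambda>t. t - 1"]) (auto simp: algebra_simps)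
  then show ?thesis by (simp add: wt_def atLeast0LessThan)
qed

lemma PP_setD:
  assumes "P \<in> PP_set s k"
  shows "is_part (fst (P j))" "is_part (snd (P j))" "finite {j. P j \<noteq> (\<lambda>_. 0, \<lambda>_. 0)}"
proof -
  have "P j \<in> P_set s k (s k)" using assms by (simp add: PP_set_def)
  then show "is_part (fst (P j))" "is_part (snd (P j))" by (auto simp: P_set_def case_prod_unfold)
  obtain r where "\<forall>j\<ge>r. P j = (\<lambda>_. 0, \<lambda>_. 0)" using assms by (auto simp: PP_set_def)
  then have "{j. P j \<noteq> (\<lambda>_. 0, \<lambda>_. 0)} \<subseteq> {..<r}" by (auto intro: ccontr simp: not_less)
  then show "finite {j. P j \<noteq> (\<lambda>_. 0, \<lambda>_. 0)}" using finite_subset by blast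
qed

lemma wtPP_slices:
  assumes P: "P \<in> PP_set s k" and L: "\<And>j i. fst (P j) i \<le> L" "\<And>j i. snd (P j) i \<le> L"
  shows "wtPP N k P = (\<Sum>l<L. of_nat (psize (slices (\<lambda>j. fst (P j)) l)) * zvar N (k + int l)) +
    (\<Sum>l<L. of_nat (psize (slices (\<lambda>j. snd (P j)) l)) * zvar N (k - 1 - int l))"
proof -
  let ?F = "{j. P j \<noteq> (\<lambda>_. 0, \<lambda>_. 0)}"
  have z: "fst (P j) = (\<lambda>_. 0)" "snd (P j) = (\<lambda>_. 0)" if "j \<notin> ?F" for j using that by auto
  have w: "wt N k (P j) = (\<Sum>i | fst (P j) i \<noteq> 0. \<Sum>t<fst (P j) i. zvar N (k + int t)) +
    (\<Sum>i | snd (P j) i \<noteq> 0. \<Sum>t<snd (P j) i. zvar N (k - 1 - int t))" for j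
    using wt_eq[of N k "fst (P j)" "snd (P j)"] by simp
  show ?thesis unfolding wtPP_def w sum.distrib
    by (rule arg_cong2[where f = "(+)",
          OF sum_slices[where Lam = "\<lambda>j. fst (P j)", OF PP_setD(3)[OF P] z(1) PP_setD(1)[OF P] L(1)]
             sum_slices[where Lam = "\<lambda>j. snd (P j)", OF PP_setD(3)[OF P] z(2) PP_setD(2)[OF P] L(2)]])
qed

text \<open>Every entry is a number of boxes, and each box contributes 1 to the degree. Hence
  bounding entries by the degree of a coefficient omits no plane partition counted there.\<close>

lemma le_deg_wtPP:
  assumes P: "P \<in> PP_set s k"
  shows "fst (P j) i \<le> deg (wtPP N k P)" "snd (P j) i \<le> deg (wtPP N k P)"
proof -
  let ?F = "{j. P j \<noteq> (\<lambda>_. 0, \<lambda>_. 0)}"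
  have d: "deg (wt N k (P j)) = psize (fst (P j)) + psize (snd (P j))"
    using wt_eq[of N k "fst (P j)" "snd (P j)"] by (simp add: psize_def)
  have le: "lam i \<le> psize lam" if "is_part lam" for lam
  proof (cases "lam i = 0")
    case False
    then show ?thesis using is_part_finite[OF that, of 0] unfolding psize_def
      by (intro member_le_sum) auto
  qed simp
  have "deg (wt N k (P j)) \<le> deg (wtPP N k P)"
  proof (cases "j \<in> ?F")
    case True
    then show ?thesis unfolding wtPP_def deg_sum using PP_setD(3)[OF P] by (intro member_le_sum) auto
  next
    case False
    then have "fst (P j) = (\<lambda>_. 0)" "snd (P j) = (\<lambda>_. 0)" by auto
    then show ?thesis unfolding d by (simp add: psize_def)
  qed
  then show "fst (P j) i \<le> deg (wtPP N k P)" "snd (P j) i \<le> deg (wtPP N k P)"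
    using le[OF PP_setD(1)[OF P, of j]] le[OF PP_setD(2)[OF P, of j]] unfolding d by linarith+
qed

text \<open>The rectangle is not square: the left alphabet has the letters 0 to \<open>L\<close>,
  the right one 1 to \<open>L\<close>.\<close>

lemma bounded_PP_weq:
  fixes k :: int and L :: nat
  assumes pm: "\<And>i. s i = 1 \<or> s i = -1"
  defines "F \<equiv> {k - int L..k} \<times> {k..<k + int L}"
  shows "weq {P \<in> PP_set s k. \<forall>j i. fst (P j) i \<le> L \<and> snd (P j) i \<le> L} (wtPP N k)
    (PiE F (\<lambda>(i, j). bits (s i \<noteq> s (j + 1))))
      (\<lambda>r. \<Sum>z\<in>F. of_nat (r z) * (case z of (i, j) \<Rightarrow> zij N i j))"
proof -
  \<comment> \<open>Letters are named by the free end of their colour interval,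
    \<open>{i..<k}\<close> on the left and \<open>{k..j}\<close> on the right. As
    \<open>j = k + a - 1\<close>, the parity of the right letter \<open>a\<close> is read at
    \<open>j + 1\<close>.\<close>
  define p where "p i \<longleftrightarrow> s i \<noteq> s k" for i
  define q where "q j \<longleftrightarrow> s (j + 1) \<noteq> s k" for j
  define X where "X i = (\<Sum>t\<in>{i..<k}. zvar N t)" for i
  define Y where "Y j = (\<Sum>t\<in>{k..j}. zvar N t)" for j
  let ?f = "\<lambda>l. k - int l" and ?g = "\<lambda>l. k + int l"
  let ?xs = "map ?f [0..<Suc L]" and ?ys = "map ?g [0..<L]"
  let ?e = "\<lambda>_::nat. 0::nat"
  define wA :: "(nat \<Rightarrow> nat \<Rightarrow> nat) \<Rightarrow> mono" where "wA A = (\<Sum>l<L. of_nat (psize (A l)) * zvar N (k + int l))" for A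
  define wB :: "(nat \<Rightarrow> nat \<Rightarrow> nat) \<Rightarrow> mono" where "wB B = (\<Sum>l<L. of_nat (psize (B l)) * zvar N (k - 1 - int l))" for B
  let ?SB = "\<lambda>nu. {B. B 0 = nu \<and> (\<forall>i. strip (p (?f i)) (B (Suc i)) (B i)) \<and> (\<forall>i\<ge>Suc L. B i = ?e)}"
  let ?SA = "\<lambda>nu. {A. A 0 = nu \<and> (\<forall>i. strip (q (?g i)) (A (Suc i)) (A i)) \<and> (\<forall>i\<ge>L. A i = ?e)}"
  have Xf: "X (?f l) = (\<Sum>t<l. zvar N (k - 1 - int t))" for l
    unfolding X_def by (rule sum.reindex_bij_witness[where i = "\<lambda>t. k - 1 - int t" and j = "\<lambda>t. nat (k - 1 - t)"]) auto
  have Yg: "Y (?g l) = (\<Sum>t<Suc l. zvar N (k + int t))" for l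
    unfolding Y_def by (rule sum.reindex_bij_witness[where i = "\<lambda>t. k + int t" and j = "\<lambda>t. nat (t - k)"]) auto
  have YA: "(\<Sum>i<L. of_nat (psize (A i) - psize (A (Suc i))) * Y (?g i)) = wA A" if "A \<in> ?SA nu" for A nu
  proof -
    have "psize (A (Suc i)) \<le> psize (A i)" for i using that strip_psize by blast
    moreover have "psize (A L) = 0" using that by (simp add: psize_def)
    ultimately show ?thesis
      using abel_summation[where a = "\<lambda>i. psize (A i)" and n = L and z = "\<lambda>t. zvar N (k + int t)"] unfolding Yg wA_def by simp
  qed
  have XB: "(\<Sum>i<Suc L. of_nat (psize (B i) - psize (B (Suc i))) * X (?f i)) = wB (\<lambda>l. B (Suc l))"
    if "B \<in> ?SB nu" for B nu
  proof -
    have "psize (B (Suc i)) \<le> psize (B i)" for i using that strip_psize by blast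
    moreover have "psize (B (Suc L)) = 0" using that by (simp add: psize_def)
    \<comment> \<open>The letter 0 has the empty interval, \<open>X k = 0\<close>, so its summand
      drops out when the index is shifted and the sizes start at \<open>B 1\<close>.\<close>
    ultimately show ?thesis
      using abel_summation[where a = "\<lambda>i. psize (B (Suc i))" and n = L and z = "\<lambda>t. zvar N (k - 1 - int t)"]
      unfolding Xf wB_def by (simp add: sum.lessThan_Suc_shift[of _ L] del: sum.lessThan_Suc)
  qed
  have 1: "weq {P \<in> PP_set s k. \<forall>j i. fst (P j) i \<le> L \<and> snd (P j) i \<le> L} (wtPP N k)
    {(A, B). B 0 = A 0 \<and> (\<forall>l. strip (odd_right s k (Suc l)) (A (Suc l)) (A l)) \<and> (\<forall>l\<ge>L. A l = ?e) \<and>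
      (\<forall>l. strip (odd_left s k l) (B (Suc l)) (B l)) \<and> (\<forall>l\<ge>Suc L. B l = ?e)}
     (\<lambda>(A, B). wA A + wB (\<lambda>l. B (Suc l)))"
    (is "weq ?S _ ?C _")
  proof -
    have "weq ?S (wtPP N k) ?S (\<lambda>P. wA (slices (\<lambda>j. fst (P j))) + wB (slices (\<lambda>j. snd (P j))))"
      by (rule weq_refl) (auto simp: wtPP_slices[of _ s k L] wA_def wB_def)
    from weq_trans[OF this PP_weq_chains[OF pm]] show ?thesis .
  qed
  have 2: "weq ?C (\<lambda>(A, B). wA A + wB (\<lambda>l. B (Suc l)))
    (SIGMA nu:Collect is_part. ?SB nu \<times> ?SA nu) (\<lambda>(nu, (B, A)). wB (\<lambda>l. B (Suc l)) + wA A)"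
  proof (rule weqI[where h = "\<lambda>(A, B). (A 0, (B, A))" and h' = "\<lambda>(nu, (B, A)). (A, B)"])
    fix x assume "x \<in> ?C"
    then obtain A B where x: "x = (A, B)" "B 0 = A 0" "\<forall>l. strip (odd_right s k (Suc l)) (A (Suc l)) (A l)"
      "\<forall>l\<ge>L. A l = ?e" "\<forall>l. strip (odd_left s k l) (B (Suc l)) (B l)" "\<forall>l\<ge>Suc L. B l = ?e" by blast
    moreover have "is_part (A 0)" using x(3) strip_part by blast
    ultimately show "(case x of (A, B) \<Rightarrow> (A 0, (B, A))) \<in> (SIGMA nu:Collect is_part. ?SB nu \<times> ?SA nu) \<and>
      (case case x of (A, B) \<Rightarrow> (A 0, (B, A)) of (nu, (B, A)) \<Rightarrow> (A, B)) = x \<and>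
      (case case x of (A, B) \<Rightarrow> (A 0, (B, A)) of (nu, (B, A)) \<Rightarrow> wB (\<lambda>l. B (Suc l)) + wA A) =
      (case x of (A, B) \<Rightarrow> wA A + wB (\<lambda>l. B (Suc l)))"
      by (simp add: p_def q_def odd_right_def odd_left_def add_ac)
  next
    fix y assume "y \<in> (SIGMA nu:Collect is_part. ?SB nu \<times> ?SA nu)"
    then show "(case y of (nu, (B, A)) \<Rightarrow> (A, B)) \<in> ?C \<and>
      (case case y of (nu, (B, A)) \<Rightarrow> (A, B) of (A, B) \<Rightarrow> (A 0, (B, A))) = y"
      by (auto simp: p_def q_def odd_right_def odd_left_def add_ac)
  qed
  have 3: "weq (SIGMA nu:Collect is_part. ?SB nu \<times> ?SA nu) (\<lambda>(nu, (B, A)). wB (\<lambda>l. B (Suc l)) + wA A)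
    (SIGMA nu:Collect is_part. tab p ?xs ?e nu \<times> tab q ?ys ?e nu) (\<lambda>(nu, (c, d)). tabw X ?xs nu c + tabw Y ?ys nu d)"
  proof (rule weq_Sigma_uncurried)
    fix nu
    have B: "weq (?SB nu) (\<lambda>B. wB (\<lambda>l. B (Suc l))) (tab p ?xs ?e nu) (tabw X ?xs nu)"
      by (rule weq_trans[OF weq_refl weq_sym[OF tab_chain]]) (use XB in simp)
    have A: "weq (?SA nu) wA (tab q ?ys ?e nu) (tabw Y ?ys nu)"
      by (rule weq_trans[OF weq_refl weq_sym[OF tab_chain]]) (use YA in simp)
    show "weq (?SB nu \<times> ?SA nu) (\<lambda>x. case (nu, x) of (nu, (B, A)) \<Rightarrow> wB (\<lambda>l. B (Suc l)) + wA A)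
      (tab p ?xs ?e nu \<times> tab q ?ys ?e nu)
      (\<lambda>x. case (nu, x) of (nu, (c, d)) \<Rightarrow> tabw X ?xs nu c + tabw Y ?ys nu d)"
      unfolding prod.case by (rule weq_prod[OF B A, where F = "(+)"])
  qed
  have d: "distinct ?xs" "distinct ?ys" by (auto simp: distinct_map inj_on_def simp del: upt_Suc)
  have "set ?xs = {k - int L..k}"
    unfolding set_map set_upt by (auto simp: image_iff intro!: bexI[where x = "nat (k - _)"])
  moreover have "set ?ys = {k..<k + int L}"
    unfolding set_map set_upt by (auto simp: image_iff intro!: bexI[where x = "nat (_ - k)"])
  ultimately have FL: "set ?xs \<times> set ?ys = F" by (simp add: F_def)
  have "mats p q F = PiE F (\<lambda>(i, j). bits (s i \<noteq> s (j + 1)))"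
  proof -
    \<comment> \<open>With only two signs available, comparing both parities with \<open>s k\<close>
      cancels \<open>s k\<close>.\<close>
    have "(p i \<noteq> q j) \<longleftrightarrow> s i \<noteq> s (j + 1)" for i j
      using pm[of i] pm[of "j + 1"] pm[of k] by (auto simp: p_def q_def)
    then show ?thesis by (simp add: mats_def)
  qed
  moreover have "matw X Y F = (\<lambda>r. \<Sum>z\<in>F. of_nat (r z) * (case z of (i, j) \<Rightarrow> zij N i j))"
  proof -
    have "X i + Y j = zij N i j" if "i \<le> k" "k \<le> j" for i j
    proof -
      have "{i..j} = {i..<k} \<union> {k..j}" using that by auto
      then show ?thesis unfolding X_def Y_def zij_def by (simp only:) (rule sum.union_disjoint[symmetric], auto)
    qed
    then show ?thesis unfolding matw_def F_def by (intro ext sum.cong) auto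
  qed
  ultimately have 4: "weq (SIGMA nu:Collect is_part. tab p ?xs ?e nu \<times> tab q ?ys ?e nu) 
      (\<lambda>(nu, (c, d)). tabw X ?xs nu c + tabw Y ?ys nu d)
    (PiE F (\<lambda>(i, j). bits (s i \<noteq> s (j + 1))))
      (\<lambda>r. \<Sum>z\<in>F. of_nat (r z) * (case z of (i, j) \<Rightarrow> zij N i j))"
    using super_cauchy[OF d, of p q X Y] unfolding FL by simp
  show ?thesis by (rule weq_trans[OF weq_trans[OF weq_trans[OF 1 2] 3] 4])
qed

text \<open>A factor outside \<open>F0\<close> has degree above that of \<open>a\<close>, so even a
  single use would overshoot: its multiplicity is 0 in every solution.\<close>

lemma card_PiE_restrict:
  assumes "finite F" "F0 \<subseteq> F" and S: "\<And>z. z \<in> F - F0 \<Longrightarrow> 0 \<in> S z"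
    and W: "\<And>z. z \<in> F - F0 \<Longrightarrow> deg (W z) > deg a"
  shows "card {r \<in> PiE F S. (\<Sum>z\<in>F. of_nat (r z) * W z) = a} = 
    card {r \<in> PiE F0 S. (\<Sum>z\<in>F0. of_nat (r z) * W z) = a}" (is "card ?A = card ?B")
proof -
  let ?h = "\<lambda>r. restrict r F0" and ?h' = "\<lambda>r. \<lambda>z\<in>F. if z \<in> F0 then r z else 0"
  have z: "r z = 0" if "r \<in> ?A" "z \<in> F - F0" for r z
  proof (rule ccontr)
    assume "r z \<noteq> 0"
    have "r z * deg (W z) \<le> (\<Sum>z\<in>F. r z * deg (W z))"
      by (rule member_le_sum) (use that assms in auto)
    also have "\<dots> = deg a" using that(1) by auto
    finally have "r z * deg (W z) \<le> deg a" .
    moreover have "deg (W z) \<le> r z * deg (W z)" using \<open>r z \<noteq> 0\<close> by simp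
    ultimately show False using W[OF that(2)] by linarith
  qed
  have split: "(\<Sum>z\<in>F. of_nat (r z) * W z) = (\<Sum>z\<in>F0. of_nat (r z) * W z)" if "\<And>z. z \<in> F - F0 \<Longrightarrow> r z = 0" for r
    by (rule sum.mono_neutral_right) (use assms that in auto)
  have 1: "\<forall>r\<in>?A. ?h' (?h r) = r"
  proof
    fix r assume r: "r \<in> ?A"
    show "?h' (?h r) = r" by (rule extensionalityI[of _ F]) (use r z[OF r] in \<open>auto simp: PiE_iff\<close>)
  qed
  have 2: "\<forall>r\<in>?B. ?h (?h' r) = r"
  proof
    fix r assume r: "r \<in> ?B"
    show "?h (?h' r) = r" by (rule extensionalityI[of _ F0]) (use r assms(2) in \<open>auto simp: PiE_iff\<close>)
  qed
  have 3: "?h ` ?A \<subseteq> ?B"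
  proof (rule image_subsetI)
    fix r assume r: "r \<in> ?A"
    then show "?h r \<in> ?B" using split[OF z[OF r]] assms(2) by (auto simp: PiE_iff)
  qed
  have 4: "?h' ` ?B \<subseteq> ?A"
  proof (rule image_subsetI)
    fix r assume r: "r \<in> ?B"
    have "(\<Sum>z\<in>F. of_nat (?h' r z) * W z) = (\<Sum>z\<in>F0. of_nat (?h' r z) * W z)" by (rule split) auto
    also have "\<dots> = a" using r assms(2) by (auto intro!: sum.cong)
    finally show "?h' r \<in> ?A" using r S assms(2) by (auto simp: PiE_iff)
  qed
  show ?thesis by (rule bij_betw_same_card[OF bij_betw_byWitness[OF 1 2 3 4]])
qed

lemma finite_weighted_PiE:
  assumes "finite F" "\<And>z. z \<in> F \<Longrightarrow> deg (W z) > 0"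
  shows "finite {r \<in> PiE F S. (\<Sum>z\<in>F. of_nat (r z) * W z) = a}"
proof (rule finite_subset)
  show "{r \<in> PiE F S. (\<Sum>z\<in>F. of_nat (r z) * W z) = a} \<subseteq> PiE F (\<lambda>_. {..deg a})"
  proof clarify
    fix r assume r: "r \<in> PiE F S"
    have "r z \<le> deg (\<Sum>z\<in>F. of_nat (r z) * W z)" if "z \<in> F" for z
    proof -
      have "r z * 1 \<le> r z * deg (W z)" using assms(2)[OF that] by (intro mult_left_mono) auto
      also have "\<dots> \<le> (\<Sum>z\<in>F. r z * deg (W z))"
        by (rule member_le_sum) (use that assms in auto)
      finally show ?thesis by simp
    qed
    then show "r \<in> PiE F (\<lambda>_. {..deg (\<Sum>z\<in>F. of_nat (r z) * W z)})" using r by (auto simp: PiE_iff)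
  qed
  show "finite (PiE F (\<lambda>_. {..deg a}))" using assms(1) by (intro finite_PiE) auto
qed

theorem theorem7p6:
  fixes m n :: nat and s :: "int \<Rightarrow> int" and k :: int
  assumes "parity_seq m n s"
    and "0 \<le> k" and "k < int (m + n)"
  shows "mfps_net_converges (PP_set s k) (\<lambda>F. mfps_sum F (\<lambda>P. mfps_monom 1 (wtPP (m + n) k P)))
       \<and> mfps_net_converges {(i, j). i \<le> k \<and> k \<le> j} (\<lambda>F. mfps_prod F (macfactor (m + n) s))
       \<and> mfps_infsum (PP_set s k) (\<lambda>P. mfps_monom 1 (wtPP (m + n) k P))
         = mfps_infprod {(i, j). i \<le> k \<and> k \<le> j} (macfactor (m + n) s)"
proof -
  let ?N = "m + n" and ?I = "{(i, j). i \<le> k \<and> k \<le> j}"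
  let ?Gs = "\<lambda>F. mfps_sum F (\<lambda>P. mfps_monom 1 (wtPP ?N k P))" and ?Gp = "\<lambda>F. mfps_prod F (macfactor ?N s)"
  let ?S = "\<lambda>(i, j). bits (s i \<noteq> s (j + 1))" and ?W = "\<lambda>(i, j). zij ?N i j"
  \<comment> \<open>The rectangle of \<open>bounded_PP_weq\<close> at \<open>L = deg a\<close>. A
    pair of \<open>?I\<close> outside it spans more than \<open>deg a\<close> positions.\<close>
  define FL where "FL a = {k - int (deg a)..k} \<times> {k..<k + int (deg a)}" for a
  define PPa where "PPa a = {P \<in> PP_set s k. wtPP ?N k P = a}" for a
  have pm: "\<And>i. s i = 1 \<or> s i = -1" using assms(1) by (simp add: parity_seq_def)
  have FL: "finite (FL a)" "FL a \<subseteq> ?I" for a by (auto simp: FL_def)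
  have degW: "deg (?W z) > 0" if "z \<in> ?I" for z using that by (auto simp: deg_zij)
  have fin: "finite (PPa a)"
    and card: "card (PPa a) = card {r \<in> PiE (FL a) ?S. (\<Sum>z\<in>FL a. of_nat (r z) * ?W z) = a}" for a
  proof -
    have "PPa a = {P \<in> {P \<in> PP_set s k. \<forall>j i. fst (P j) i \<le> deg a \<and> snd (P j) i \<le> deg a}. wtPP ?N k P = a}"
      using le_deg_wtPP by (auto simp: PPa_def)
    moreover have "finite {r \<in> PiE (FL a) ?S. (\<Sum>z\<in>FL a. of_nat (r z) * ?W z) = a}"
      by (rule finite_weighted_PiE[OF FL(1)]) (use degW FL(2) in blast)
    ultimately show "finite (PPa a)"
      "card (PPa a) = card {r \<in> PiE (FL a) ?S. (\<Sum>z\<in>FL a. of_nat (r z) * ?W z) = a}"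
      using weq_finite_card[OF bounded_PP_weq[where s = s and k = k and L = "deg a" and N = ?N, OF pm], of a] by (simp_all add: FL_def)
  qed
  have sum: "?Gs F a = int (card (PPa a))" if "finite F" "PPa a \<subseteq> F" "F \<subseteq> PP_set s k" for F a
  proof -
    have "{P \<in> F. a = wtPP ?N k P} = PPa a" using that by (auto simp: PPa_def)
    then show ?thesis using that(1) sum.inter_filter[OF that(1), of "\<lambda>_. 1 :: int" "\<lambda>P. a = wtPP ?N k P"]
      by (simp add: mfps_sum_def mfps_monom_def)
  qed
  have prod: "?Gp F a = int (card (PPa a))" if F: "finite F" "FL a \<subseteq> F" "F \<subseteq> ?I" for F a
  proof -
    have "?Gp F a = int (card {r \<in> PiE F ?S. (\<Sum>z\<in>F. of_nat (r z) * ?W z) = a})"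
    proof (rule mfps_prod_coeff[OF F(1)])
      fix z b assume "z \<in> F"
      moreover obtain i j where z: "z = (i, j)" by (cases z)
      ultimately have "i \<le> j" using F(3) by auto
      then show "macfactor ?N s z b = (if \<exists>r\<in>?S z. b = of_nat r * ?W z then 1 else 0)"
        unfolding z prod.case by (rule macfactor_coeff[OF pm])
    qed (use F(3) degW in blast)
    also have "card {r \<in> PiE F ?S. (\<Sum>z\<in>F. of_nat (r z) * ?W z) = a} =
      card {r \<in> PiE (FL a) ?S. (\<Sum>z\<in>FL a. of_nat (r z) * ?W z) = a}"
    proof (rule card_PiE_restrict[OF F(1,2)])
      fix z assume z: "z \<in> F - FL a"
      show "0 \<in> ?S z" by (cases z) (simp add: bits_def)
      obtain i j where ij: "z = (i, j)" by (cases z)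
      then have "i \<le> k" "k \<le> j" using z F(3) by auto
      then show "deg a < deg (?W z)" using z by (auto simp: ij FL_def deg_zij)
    qed
    finally show ?thesis using card by simp
  qed
  have PPa: "PPa a \<subseteq> PP_set s k" for a by (auto simp: PPa_def)
  have "mfps_net_converges (PP_set s k) ?Gs"
    unfolding mfps_net_converges_def using fin PPa sum by meson
  moreover have "mfps_net_converges ?I ?Gp"
    unfolding mfps_net_converges_def using FL prod by meson
  moreover have "mfps_infsum (PP_set s k) (\<lambda>P. mfps_monom 1 (wtPP ?N k P)) = mfps_infprod ?I (macfactor ?N s)"
  proof
    fix a
    \<comment> \<open>Both nets are constant at \<open>a\<close> from the stages
      \<open>PPa a\<close> and \<open>FL a\<close> on, with the same value.\<close>
    have "mfps_net_lim (PP_set s k) ?Gs a = int (card (PPa a))"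
      by (rule net_limI[OF fin PPa]) (rule sum)
    moreover have "mfps_net_lim ?I ?Gp a = int (card (PPa a))"
      by (rule net_limI[OF FL]) (rule prod)
    ultimately show "mfps_infsum (PP_set s k) (\<lambda>P. mfps_monom 1 (wtPP ?N k P)) a = mfps_infprod ?I (macfactor ?N s) a"
      by (simp add: mfps_infsum_def mfps_infprod_def)
  qed
  ultimately show ?thesis by blast
qed

end
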